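(* Let $\Sigma$ be a surface with at least one puncture and $\chi(\Sigma)<0$, with a decorated hyperbolic metric $(m,r)$ and an ideal triangulation $T$. Let $\alpha$ be a loop or an arc on $\Sigma$, with geodesic representative $\overline\alpha$, and let the edges $e_{j_1},\dots,e_{j_n}$ crossed by $\overline\alpha$, their $\lambda$-lengths $\lambda_{j_k}$ and the matrices $M_k$ be as defined in the context. Then $$\lambda(\alpha)=\begin{cases}\dfrac{\operatorname{tr}(M_1\cdots M_n)}{\lambda_{j_1}\cdots\lambda_{j_n}}, & \text{if }\alpha\text{ is a loop},\\[3mm] \dfrac{M_1\cdots M_{n+1}}{\lambda_{j_1}\cdots\lambda_{j_n}}, & \text{if }\alpha\text{ is an arc}.\end{cases}$$
   Context: $\Sigma=\overline\Sigma\setminus V$ with $\overline\Sigma$ closed oriented and $V$ a finite set of punctures. A decorated hyperbolic metric $(m,r)$ is a complete finite-area hyperbolic metric $m$ on $\Sigma$ with, for each puncture $v$, a number $r(v)>0$, viewed as the choice of a horocycle of length $r(v)$ at $v$. For an arc $\alpha$ between punctures, $l(\alpha)$ is the signed length of the segment of (a lift to $\mathbb{H}^2$ of) its geodesic representative between the two horocycles at its ends (positive if the horocycles are disjoint, negative if they intersect), and $\lambda(\alpha)=e^{l(\alpha)/2}$. For a loop $\alpha$ with geodesic representative of length $l(\alpha)$, $\lambda(\alpha)=2\cosh\frac{l(\alpha)}2$. $T$ is an ideal triangulation (maximal collection of isotopy classes of simple arcs between punctures decomposing $\Sigma$ into ideal triangles), with triangles $\Delta_1,\dots,\Delta_s$,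 edges $e_1,\dots,e_t$ (realized by geodesics), and $\lambda_i=\lambda(e_i)$. Let $\overline\alpha$ be the unique geodesic homotopic to $\alpha$, with an arbitrary chosen orientation. If $\alpha$ is a loop, let $\Delta_{i_1},\dots,\Delta_{i_n}$ be the successive triangles crossed by $\overline\alpha$, starting at some point inside the first, and $e_{j_1},\dots,e_{j_n}$ the successive edges crossed, with $e_{j_k}$ shared by $\Delta_{i_k}$ and $\Delta_{i_{k+1}}$ for $1\le k\le n-1$ and $e_{j_n}$ shared by $\Delta_{i_n}$ and $\Delta_{i_1}$. If $\alpha$ is an arc (not homotopic to an edge of $T$), list triangles $\Delta_{i_1},\dots,\Delta_{i_{n+1}}$ and crossed edges $e_{j_1},\dots,e_{j_n}$ accordingly, $\Delta_{i_1}$ containing the beginning vertex and $\Delta_{i_{n+1}}$ the end vertex. Triangles and edges may be repeated. For a triangle $\Delta_{i_k}$ which $\overline\alpha$ enters through one side and leaves through another, let $b$ be the side through which it enters, and let $l$ and $r$ be the other two sides, lying to the left and to the right respectively as seen when entering through $b$. If $\overline\alpha$ turns left (exits through $l$), set $$M_k=\begin{pmatrix}\lambda_b&\lambda_r\\0&\lambda_l\end{pmatrix};$$ if it turns right (exits through $r$), set $$M_k=\begin{pmatrix}\lambda_r&0\\ \lambda_l&\lambda_b\end{pmatrix}.$$ If $\alpha$ is an arc, let $\lambda_{\mathrm{left}},\lambda_{\mathrm{right}}$ be the $\lambda$-lengths of the two sides of $\Delta_{i_1}$ adjacent to the beginning vertex lying respectively to the left and to the right of $\overline\alpha$ (with respect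 to its orientation), and $\lambda'_{\mathrm{left}},\lambda'_{\mathrm{right}}$ those of the two sides of $\Delta_{i_{n+1}}$ adjacent to the end vertex lying to the left and to the right of $\overline\alpha$; set $$M_1=(\lambda_{\mathrm{left}}\ \ \lambda_{\mathrm{right}}),\qquad M_{n+1}=\begin{pmatrix}\lambda'_{\mathrm{right}}\\ \lambda'_{\mathrm{left}}\end{pmatrix}.$$ *)

theory Defs
  imports "HOL-Analysis.Analysis"
begin

section \<open>The hyperbolic plane\<close>

abbreviation upper_half_plane :: "complex set" where
  "upper_half_plane \<equiv> {z. 0 < Im z}"

definition hyp_dist :: "complex \<Rightarrow> complex \<Rightarrow> real" where
  "hyp_dist z w = arcosh (1 + (cmod (z - w))\<^sup>2 / (2 * Im z * Im w))"

definition hyp_area :: "complex measure" where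
  "hyp_area = density lborel (\<lambda>z. ennreal (1 / (Im z)\<^sup>2))"

definition mat2 :: "real \<Rightarrow> real \<Rightarrow> real \<Rightarrow> real \<Rightarrow> real^2^2" where
  "mat2 a b c d = vector [vector [a, b], vector [c, d]]"

definition SL2R :: "(real^2^2) set" where
  "SL2R = {A. det A = 1}"

definition mob :: "real^2^2 \<Rightarrow> complex \<Rightarrow> complex" where
  "mob A z = (of_real (A$1$1) * z + of_real (A$1$2)) / (of_real (A$2$1) * z + of_real (A$2$2))"

text \<open>
  The orientation-preserving isometries of the upper half-plane are the maps \<open>mob A\<close> with
  \<open>A \<in> SL2R\<close>, and the oriented unit-speed geodesic lines are their compositions with the
  vertical line \<open>s \<mapsto> \<i> e\<^sup>s\<close>.  An oriented parametrised geodesic line is therefore given by a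
  matrix \<open>A \<in> SL2R\<close>, unique up to sign.
\<close>

definition geod :: "real^2^2 \<Rightarrow> real \<Rightarrow> complex" where
  "geod A s = mob A (\<i> * of_real (exp s))"

text \<open>The same line run backwards: \<open>geod (rev_geod A) s = geod A (- s)\<close>.\<close>

definition rev_geod :: "real^2^2 \<Rightarrow> real^2^2" where
  "rev_geod A = A ** mat2 0 (-1) 1 0"

definition left_side :: "real^2^2 \<Rightarrow> complex set" where
  "left_side A = mob A ` {z. 0 < Im z \<and> Re z < 0}"

text \<open>Two lines have the same forward end point at infinity.\<close>

definition asymptotic :: "real^2^2 \<Rightarrow> real^2^2 \<Rightarrow> bool" where
  "asymptotic A B \<longleftrightarrow> (\<exists>K. \<forall>s\<ge>0. hyp_dist (geod A s) (geod B s) \<le> K)"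

text \<open>
  An ideal triangle is given by its three sides, oriented as its boundary and listed in
  counterclockwise order, so that the interior is to the left of each of them.  (If the three
  lines run around the triangle clockwise, then their left sides are disjoint.)
  Someone who enters through the side \<open>b\<close> has the next side \<open>r\<close> on the right
  and the remaining side \<open>l\<close> on the left.
\<close>

definition tri_interior :: "real^2^2 \<Rightarrow> real^2^2 \<Rightarrow> real^2^2 \<Rightarrow> complex set" where
  "tri_interior b r l = left_side b \<inter> left_side r \<inter> left_side l"

definition ideal_triangle :: "real^2^2 \<Rightarrow> real^2^2 \<Rightarrow> real^2^2 \<Rightarrow> bool" where
  "ideal_triangle b r l \<longleftrightarrow> {b, r, l} \<subseteq> SL2R \<and>
     asymptotic b (rev_geod r) \<and> asymptotic r (rev_geod l) \<and> asymptotic l (rev_geod b) \<and>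
     tri_interior b r l \<noteq> {}"


section \<open>Hyperbolic metrics on a punctured surface\<close>

text \<open>
  \<open>S\<close> is the closed surface, \<open>V\<close> the set of punctures, and \<open>X\<close> stands for \<open>S - V\<close>.
\<close>

definition closed_surface :: "'a::t2_space set \<Rightarrow> bool" where
  "closed_surface S \<longleftrightarrow> S \<noteq> {} \<and> compact S \<and> connected S \<and>
     (\<forall>x\<in>S. \<exists>U. openin (top_of_set S) U \<and> x \<in> U \<and> U homeomorphic ball (0::complex) 1)"

text \<open>
  A complete hyperbolic metric, given by its distance function: a complete geodesic metric
  inducing the topology of \<open>X\<close> and locally isometric to the hyperbolic plane.
\<close>

definition complete_hyperbolic_metric :: "'a::t2_space set \<Rightarrow> ('a \<Rightarrow> 'a \<Rightarrow> real) \<Rightarrow> bool" where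
  "complete_hyperbolic_metric X d \<longleftrightarrow>
     Metric_space X d \<and> Metric_space.mtopology X d = top_of_set X \<and> Metric_space.mcomplete X d \<and>
     (\<forall>x\<in>X. \<forall>y\<in>X. \<exists>c. c 0 = x \<and> c (d x y) = y \<and> c ` {0..d x y} \<subseteq> X \<and>
        (\<forall>s\<in>{0..d x y}. \<forall>t\<in>{0..d x y}. d (c s) (c t) = \<bar>s - t\<bar>)) \<and>
     (\<forall>x\<in>X. \<exists>\<epsilon>>0. \<exists>f.
        f ` Metric_space.mball X d x \<epsilon> = {w \<in> upper_half_plane. hyp_dist (f x) w < \<epsilon>} \<and>
        (\<forall>y\<in>Metric_space.mball X d x \<epsilon>. \<forall>z\<in>Metric_space.mball X d x \<epsilon>.
           hyp_dist (f y) (f z) = d y z))"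

text \<open>
  The identification of the universal covering of the hyperbolic surface \<open>(X, d)\<close> with the
  hyperbolic plane.  That the deck transformations preserve orientation expresses that
  \<open>X\<close> is oriented, with the orientation for which \<open>p\<close> is orientation-preserving.
\<close>

definition oriented_universal_covering ::
    "(complex \<Rightarrow> 'a::t2_space) \<Rightarrow> 'a set \<Rightarrow> ('a \<Rightarrow> 'a \<Rightarrow> real) \<Rightarrow> bool" where
  "oriented_universal_covering p X d \<longleftrightarrow>
     covering_space upper_half_plane p X \<and>
     (\<forall>z\<in>upper_half_plane. \<exists>\<epsilon>>0. \<forall>w\<in>upper_half_plane. \<forall>w'\<in>upper_half_plane.
        hyp_dist z w < \<epsilon> \<and> hyp_dist z w' < \<epsilon> \<longrightarrow> d (p w) (p w') = hyp_dist w w') \<and>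
     (\<forall>z\<in>upper_half_plane. \<forall>w\<in>upper_half_plane. p z = p w \<longrightarrow>
        (\<exists>A\<in>SL2R. mob A z = w \<and> (\<forall>u\<in>upper_half_plane. p (mob A u) = p u)))"

text \<open>The area of \<open>X\<close> is that of a Borel set of representatives in the hyperbolic plane.\<close>

definition finite_area :: "(complex \<Rightarrow> 'a) \<Rightarrow> 'a set \<Rightarrow> bool" where
  "finite_area p X \<longleftrightarrow>
     (\<exists>D\<in>sets borel. D \<subseteq> upper_half_plane \<and> bij_betw p D X \<and> emeasure hyp_area D < \<infinity>)"

definition ends_at :: "(complex \<Rightarrow> 'a::t2_space) \<Rightarrow> real^2^2 \<Rightarrow> 'a \<Rightarrow> bool" where
  "ends_at p A v \<longleftrightarrow> ((\<lambda>s. p (geod A s)) \<longlongrightarrow> v) at_top"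

text \<open>
  The horocycle centred at the forward end point of \<open>geod A\<close> and passing through \<open>geod A t\<close> is
  \<open>mob A ` {z. Im z = e\<^sup>t}\<close>.  If the deck transformations that fix this end point are
  generated by the conjugate by \<open>mob A\<close> of \<open>z \<mapsto> z + \<tau>\<close> with \<open>\<tau> > 0\<close>, then it projects to a
  closed curve in \<open>X\<close>, of length \<open>\<tau> / e\<^sup>t\<close>.
\<close>

definition horocycle_length :: "(complex \<Rightarrow> 'a) \<Rightarrow> real^2^2 \<Rightarrow> real \<Rightarrow> real \<Rightarrow> bool" where
  "horocycle_length p A t \<rho> \<longleftrightarrow> (\<exists>\<tau>>0.
     (\<forall>z\<in>upper_half_plane. p (mob A (z + of_real \<tau>)) = p (mob A z)) \<and>
     (\<forall>\<sigma>. 0 < \<sigma> \<and> \<sigma> < \<tau> \<longrightarrow>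
        (\<exists>z\<in>upper_half_plane. p (mob A (z + of_real \<sigma>)) \<noteq> p (mob A z))) \<and>
     \<rho> = \<tau> / exp t)"

text \<open>
  A decoration: there is a horocycle of length \<open>r v\<close> at the puncture \<open>v\<close>, that is, every
  geodesic running into \<open>v\<close> meets a lift of it, centred at its end point, orthogonally.
\<close>

definition decoration :: "(complex \<Rightarrow> 'a::t2_space) \<Rightarrow> 'a set \<Rightarrow> ('a \<Rightarrow> real) \<Rightarrow> bool" where
  "decoration p V r \<longleftrightarrow> (\<forall>v\<in>V. r v > 0 \<and>
     (\<forall>A\<in>SL2R. ends_at p A v \<longrightarrow> (\<exists>t. horocycle_length p A t (r v))))"


section \<open>Lambda-lengths\<close>

text \<open>The time at which \<open>geod A\<close> meets the horocycle at its forward end.\<close>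

definition horo_time :: "(complex \<Rightarrow> 'a::t2_space) \<Rightarrow> ('a \<Rightarrow> real) \<Rightarrow> real^2^2 \<Rightarrow> real" where
  "horo_time p r A = (THE t. \<exists>v. ends_at p A v \<and> horocycle_length p A t (r v))"

text \<open>
  The line meets the horocycle at its backward end at time \<open>- horo_time p r (rev_geod A)\<close>, and
  the two horocycles are disjoint iff this is less than \<open>horo_time p r A\<close>.
\<close>

definition signed_length :: "(complex \<Rightarrow> 'a::t2_space) \<Rightarrow> ('a \<Rightarrow> real) \<Rightarrow> real^2^2 \<Rightarrow> real" where
  "signed_length p r A = horo_time p r A - (- horo_time p r (rev_geod A))"

definition lambda_arc :: "(complex \<Rightarrow> 'a::t2_space) \<Rightarrow> ('a \<Rightarrow> real) \<Rightarrow> real^2^2 \<Rightarrow> real" where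
  "lambda_arc p r A = exp (signed_length p r A / 2)"

definition lambda_loop :: "real \<Rightarrow> real" where
  "lambda_loop len = 2 * cosh (len / 2)"


section \<open>Loops and arcs\<close>

definition is_loop :: "'a::t2_space set \<Rightarrow> (real \<Rightarrow> 'a) \<Rightarrow> bool" where
  "is_loop X \<alpha> \<longleftrightarrow> path \<alpha> \<and> path_image \<alpha> \<subseteq> X \<and> pathfinish \<alpha> = pathstart \<alpha>"

text \<open>
  A lift \<open>geod A\<close> of the geodesic representative of the loop \<open>\<alpha>\<close>, with either orientation;
  \<open>len\<close> is the length of the closed geodesic, which need not be primitive.
\<close>

definition loop_geodesic ::
    "(complex \<Rightarrow> 'a::t2_space) \<Rightarrow> 'a set \<Rightarrow> (real \<Rightarrow> 'a) \<Rightarrow> real^2^2 \<Rightarrow> real \<Rightarrow> bool" where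
  "loop_geodesic p X \<alpha> A len \<longleftrightarrow> A \<in> SL2R \<and> len > 0 \<and>
     (\<forall>s. p (geod A (s + len)) = p (geod A s)) \<and>
     (\<exists>\<beta>\<in>{\<alpha>, reversepath \<alpha>}. homotopic_loops X \<beta> (\<lambda>u. p (geod A (len * u))))"

definition is_arc :: "'a::t2_space set \<Rightarrow> 'a set \<Rightarrow> (real \<Rightarrow> 'a) \<Rightarrow> bool" where
  "is_arc S V \<alpha> \<longleftrightarrow> path \<alpha> \<and> \<alpha> 0 \<in> V \<and> \<alpha> 1 \<in> V \<and> \<alpha> ` {0<..<1} \<subseteq> S - V"

definition homotopic_arcs :: "'a::t2_space set \<Rightarrow> 'a set \<Rightarrow> (real \<Rightarrow> 'a) \<Rightarrow> (real \<Rightarrow> 'a) \<Rightarrow> bool" where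
  "homotopic_arcs S V \<alpha> \<beta> \<longleftrightarrow>
     homotopic_with_canon (\<lambda>h. h 0 = \<alpha> 0 \<and> h 1 = \<alpha> 1 \<and> h ` {0<..<1} \<subseteq> S - V) {0..1} S \<alpha> \<beta>"

text \<open>The projection of the line \<open>geod A\<close> as an arc from \<open>v\<close> to \<open>w\<close>, parametrised by \<open>{0..1}\<close>.\<close>

definition arc_path :: "(complex \<Rightarrow> 'a) \<Rightarrow> real^2^2 \<Rightarrow> 'a \<Rightarrow> 'a \<Rightarrow> real \<Rightarrow> 'a" where
  "arc_path p A v w u =
     (if u \<le> 0 then v else if u \<ge> 1 then w else p (geod A (ln (u / (1 - u)))))"

definition arc_geodesic ::
    "(complex \<Rightarrow> 'a::t2_space) \<Rightarrow> 'a set \<Rightarrow> 'a set \<Rightarrow> (real \<Rightarrow> 'a) \<Rightarrow> real^2^2 \<Rightarrow> bool" where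
  "arc_geodesic p S V \<alpha> A \<longleftrightarrow> A \<in> SL2R \<and>
     (\<exists>v\<in>V. \<exists>w\<in>V. ends_at p (rev_geod A) v \<and> ends_at p A w \<and>
        (\<exists>\<beta>\<in>{\<alpha>, reversepath \<alpha>}. homotopic_arcs S V \<beta> (arc_path p A v w)))"


section \<open>Ideal triangulations\<close>

text \<open>
  An ideal triangulation is given by the set \<open>E\<close> of its edges, realised by geodesics; an
  edge is the set of its points in \<open>S - V\<close>.
\<close>

definition projected :: "(complex \<Rightarrow> 'a) \<Rightarrow> real^2^2 \<Rightarrow> 'a set" where
  "projected p A = p ` range (geod A)"

definition edge_lift :: "(complex \<Rightarrow> 'a) \<Rightarrow> 'a set set \<Rightarrow> real^2^2 \<Rightarrow> bool" where
  "edge_lift p E A \<longleftrightarrow> A \<in> SL2R \<and> projected p A \<in> E"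

definition faces :: "'a::t2_space set \<Rightarrow> 'a set set \<Rightarrow> 'a set set" where
  "faces X E = components (X - \<Union>E)"

text \<open>
  A lift of a triangle of the triangulation.  Its interior projects injectively, but two of
  its sides may project to the same edge.
\<close>

definition triangle_lift ::
    "(complex \<Rightarrow> 'a::t2_space) \<Rightarrow> 'a set \<Rightarrow> 'a set set \<Rightarrow> real^2^2 \<Rightarrow> real^2^2 \<Rightarrow> real^2^2 \<Rightarrow> bool" where
  "triangle_lift p X E b r l \<longleftrightarrow> ideal_triangle b r l \<and>
     edge_lift p E b \<and> edge_lift p E r \<and> edge_lift p E l \<and>
     inj_on p (tri_interior b r l) \<and> p ` tri_interior b r l \<in> faces X E"

definition ideal_triangulation ::
    "(complex \<Rightarrow> 'a::t2_space) \<Rightarrow> 'a set \<Rightarrow> 'a set \<Rightarrow> 'a set set \<Rightarrow> bool" where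
  "ideal_triangulation p S V E \<longleftrightarrow> finite E \<and> pairwise disjnt E \<and>
     (\<forall>e\<in>E. \<exists>A\<in>SL2R. e = projected p A \<and> inj (\<lambda>s. p (geod A s)) \<and>
        (\<exists>v\<in>V. \<exists>w\<in>V. ends_at p (rev_geod A) v \<and> ends_at p A w)) \<and>
     (\<forall>F\<in>faces (S - V) E. \<exists>b r l. triangle_lift p (S - V) E b r l \<and> F = p ` tri_interior b r l)"

text \<open>
  The Euler characteristic of \<open>S - V\<close> is that of \<open>S\<close>, computed from the cell decomposition with
  vertices \<open>V\<close>, minus the number of points removed.
\<close>

definition euler_char :: "'a::t2_space set \<Rightarrow> 'a set \<Rightarrow> 'a set set \<Rightarrow> int" where
  "euler_char S V E =
     (int (card V) - int (card E) + int (card (faces (S - V) E))) - int (card V)"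


section \<open>The sequences of crossed edges and triangles\<close>

text \<open>
  At the times \<open>t 1 < \<dots> < t n\<close>, which are all the times in \<open>J\<close> at which the projection of
  \<open>geod A\<close> is on an edge, \<open>geod A\<close> meets the lifts \<open>e 1, \<dots>, e n\<close> of edges.
\<close>

definition crossed_edges ::
    "(complex \<Rightarrow> 'a) \<Rightarrow> 'a set set \<Rightarrow> real^2^2 \<Rightarrow> real set \<Rightarrow> nat \<Rightarrow> (nat \<Rightarrow> real) \<Rightarrow> (nat \<Rightarrow> real^2^2)
      \<Rightarrow> bool" where
  "crossed_edges p E A J n t e \<longleftrightarrow>
     strict_mono_on {1..n} t \<and> t ` {1..n} = {s\<in>J. p (geod A s) \<in> \<Union>E} \<and>
     (\<forall>k\<in>{1..n}. edge_lift p E (e k) \<and> geod A (t k) \<in> range (geod (e k)))"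

text \<open>
  Between the times \<open>s\<close> and \<open>t\<close>, the line crosses the triangle with sides \<open>b\<close>, \<open>r\<close>, \<open>l\<close>,
  entering through \<open>b\<close>.
\<close>

definition crosses_triangle ::
    "(complex \<Rightarrow> 'a::t2_space) \<Rightarrow> 'a set \<Rightarrow> 'a set set \<Rightarrow> real^2^2 \<Rightarrow> real \<Rightarrow> real
      \<Rightarrow> real^2^2 \<Rightarrow> real^2^2 \<Rightarrow> real^2^2 \<Rightarrow> bool" where
  "crosses_triangle p X E A s t b r l \<longleftrightarrow> triangle_lift p X E b r l \<and>
     geod A ` {s<..<t} \<subseteq> tri_interior b r l \<and> geod A s \<in> range (geod b) \<and>
     geod A t \<in> range (geod l) \<union> range (geod r)"

definition crossing_matrix ::
    "(complex \<Rightarrow> 'a::t2_space) \<Rightarrow> ('a \<Rightarrow> real) \<Rightarrow> real^2^2 \<Rightarrow> real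
      \<Rightarrow> real^2^2 \<Rightarrow> real^2^2 \<Rightarrow> real^2^2 \<Rightarrow> real^2^2" where
  "crossing_matrix p \<rho> A t b r l =
     (if geod A t \<in> range (geod l)
      then mat2 (lambda_arc p \<rho> b) (lambda_arc p \<rho> r) 0 (lambda_arc p \<rho> l)
      else mat2 (lambda_arc p \<rho> r) 0 (lambda_arc p \<rho> l) (lambda_arc p \<rho> b))"

text \<open>
  The first triangle crossed by an arc, with the side \<open>x\<close> opposite to the beginning vertex.
  Looking from this vertex towards \<open>x\<close>, the side following \<open>x\<close> counterclockwise is on the left.
\<close>

definition starts_in_triangle ::
    "(complex \<Rightarrow> 'a::t2_space) \<Rightarrow> 'a set \<Rightarrow> 'a set set \<Rightarrow> real^2^2 \<Rightarrow> real
      \<Rightarrow> real^2^2 \<Rightarrow> real^2^2 \<Rightarrow> real^2^2 \<Rightarrow> bool" where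
  "starts_in_triangle p X E A t x left right \<longleftrightarrow> triangle_lift p X E x left right \<and>
     geod A ` {..<t} \<subseteq> tri_interior x left right \<and> geod A t \<in> range (geod x)"

definition finishes_in_triangle ::
    "(complex \<Rightarrow> 'a::t2_space) \<Rightarrow> 'a set \<Rightarrow> 'a set set \<Rightarrow> real^2^2 \<Rightarrow> real
      \<Rightarrow> real^2^2 \<Rightarrow> real^2^2 \<Rightarrow> real^2^2 \<Rightarrow> bool" where
  "finishes_in_triangle p X E A s b right left \<longleftrightarrow> triangle_lift p X E b right left \<and>
     geod A ` {s<..} \<subseteq> tri_interior b right left \<and> geod A s \<in> range (geod b)"

text \<open>\<open>matrix_prod M i j = M i ** \<dots> ** M j\<close>, the identity matrix if \<open>i > j\<close>.\<close>

definition matrix_prod :: "(nat \<Rightarrow> real^2^2) \<Rightarrow> nat \<Rightarrow> nat \<Rightarrow> real^2^2" where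
  "matrix_prod M i j = foldr (\<lambda>k P. M k ** P) [i..<Suc j] (mat 1)"

end

theory Submission
  imports Defs
begin

text \<open>
  A horocycle is encoded, up to sign, by a vector of the real plane: the one centred at the
  forward end point of \<open>geod A\<close> that this line meets at time \<open>T\<close> becomes \<open>e\<^bsup>T/2\<^esup> A e\<^sub>1\<close>
  (\<open>hvec\<close>).  The \<open>\<lambda>\<close>-length of a line is then the absolute value of the determinant of the
  vectors of its two ends (\<open>lam_eq_cross2\<close>), and the whole formula becomes linear algebra.

  A line \<open>b\<close> has a frame, the matrix with columns \<open>L\<close>, \<open>R\<close> given by its backward and its forward
  end, with signs such that the determinant is \<open>\<lambda>\<^sub>b > 0\<close>.  When \<open>b\<close> is the side through which a
  triangle is entered, \<open>L\<close> is on the left and \<open>R\<close> on the right.  The three determinants between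
  \<open>L\<close>, \<open>R\<close> and the vector \<open>Q\<close> of the opposite vertex are the \<open>\<lambda>\<close>-lengths of the sides, with
  signs dictated by the orientation, so that \<open>Q = (\<lambda>\<^sub>r L + \<lambda>\<^sub>l R) / \<lambda>\<^sub>b\<close>.  Leaving to the left
  replaces \<open>(L, R)\<close> by \<open>(L, Q)\<close>, leaving to the right by \<open>(Q, R)\<close>: both are multiplication on the
  right by the matrix of the crossing divided by \<open>\<lambda>\<^sub>b\<close> (\<open>triangle_frames\<close>).  The product of these
  matrices therefore carries the first frame to the last one, up to sign (\<open>pm_chain\<close>).

  For a loop, the last frame is the image of the first frame \<open>F\<close> under the deck transformation
  \<open>g\<close> that translates the geodesic by its length: \<open>g F = \<plusminus> F P\<close>, hence \<open>\<bar>tr g\<bar> = \<bar>tr P\<bar>\<close>, where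
  \<open>\<bar>tr g\<bar>\<close> is twice the hyperbolic cosine of half the length, and \<open>P\<close> has nonnegative entries.
  For an arc, the vectors of both ends are expressed in the frame of the first crossed edge,
  and the \<open>\<lambda>\<close>-length is their determinant.

  Three facts about the surface make this meaningful.  The vector of a decorated end depends, up
  to sign, only on the point at infinity; the point that needs an argument is that asymptotic
  lines run into the same puncture (\<open>horizontal_shift_tendsto\<close>).  Lifts of edges that meet are
  the same line (\<open>edge_lifts_meeting\<close>), so that the side through which one triangle is left is
  the side through which the next one is entered; and these two sides have opposite
  orientations (\<open>crossing_reverses\<close>).
\<close>

section \<open>Moebius transformations and real two by two matrices\<close>

lemma mat2_nth [simp]:
  "mat2 a b c d $ 1 $ 1 = a" "mat2 a b c d $ 1 $ 2 = b"
  "mat2 a b c d $ 2 $ 1 = c" "mat2 a b c d $ 2 $ 2 = d"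
  by (simp_all add: mat2_def)

lemma mat2_eq_iff: "A = mat2 a b c d \<longleftrightarrow> A$1$1 = a \<and> A$1$2 = b \<and> A$2$1 = c \<and> A$2$2 = d"
  by (auto simp: vec_eq_iff forall_2)

lemma mat2_cases: obtains a b c d where "A = mat2 a b c d"
  by (metis mat2_eq_iff)

lemma mat2_mult:
  "mat2 a b c d ** mat2 a' b' c' d' =
     mat2 (a * a' + b * c') (a * b' + b * d') (c * a' + d * c') (c * b' + d * d')"
  by (simp add: mat2_eq_iff matrix_matrix_mult_def sum_2)

lemma mat2_mult_vec: "mat2 a b c d *v vector [x, y] = vector [a * x + b * y, c * x + d * y]"
  by (simp add: vec_eq_iff forall_2 matrix_vector_mult_def sum_2)

lemma scaleR_mat2: "k *\<^sub>R mat2 a b c d = mat2 (k * a) (k * b) (k * c) (k * d)"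
  by (simp add: mat2_eq_iff)

lemma uminus_mat2: "- mat2 a b c d = mat2 (- a) (- b) (- c) (- d)"
  by (simp add: mat2_eq_iff)

lemma mat_1_mat2: "mat 1 = mat2 1 0 0 1"
  by (simp add: mat2_eq_iff mat_def)

lemma det_mat2: "det (mat2 a b c d) = a * d - b * c"
  by (simp add: det_2)

lemma mat2_SL2R: "mat2 a b c d \<in> SL2R \<longleftrightarrow> a * d - b * c = 1"
  by (simp add: SL2R_def det_mat2)

lemma SL2R_mult: "A \<in> SL2R \<Longrightarrow> B \<in> SL2R \<Longrightarrow> A ** B \<in> SL2R"
  by (simp add: SL2R_def det_mul)

text \<open>The adjugate, which on \<open>SL2R\<close> is the inverse and has polynomial entries.\<close>

definition adj2 :: "real^2^2 \<Rightarrow> real^2^2" where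
  "adj2 A = mat2 (A$2$2) (- A$1$2) (- A$2$1) (A$1$1)"

lemma adj2_SL2R: "A \<in> SL2R \<Longrightarrow> adj2 A \<in> SL2R"
  by (cases A rule: mat2_cases) (auto simp: adj2_def mat2_SL2R algebra_simps)

lemma adj2_mult:
  assumes "A \<in> SL2R"
  shows "adj2 A ** A = mat 1" "A ** adj2 A = mat 1"
proof -
  obtain a b c d where A: "A = mat2 a b c d" by (rule mat2_cases)
  have "a * d - b * c = 1" using assms by (simp add: A mat2_SL2R)
  then show "adj2 A ** A = mat 1" "A ** adj2 A = mat 1"
    by (simp_all add: A adj2_def mat2_mult mat_1_mat2 mat2_eq_iff mult.commute)
qed

lemma adj2_cancel: "A \<in> SL2R \<Longrightarrow> A ** (adj2 A ** B) = B" "A \<in> SL2R \<Longrightarrow> adj2 A ** (A ** B) = B"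
  by (simp_all add: matrix_mul_assoc adj2_mult matrix_mul_lid)

text \<open>
  Moving by an isometry, one of two lines may be taken to be the vertical one; every comparison
  of two lines below is read off from the entries \<open>a\<close>, \<open>b\<close>, \<open>c\<close>, \<open>d\<close> of the quotient.
\<close>

lemma SL2R_factor:
  assumes "A \<in> SL2R" "B \<in> SL2R"
  obtains a b c d where "B = A ** mat2 a b c d" "a * d - b * c = 1"
proof -
  obtain a b c d where N: "adj2 A ** B = mat2 a b c d" by (rule mat2_cases)
  have "mat2 a b c d \<in> SL2R"
    unfolding N[symmetric] by (intro SL2R_mult adj2_SL2R assms)
  then show ?thesis
    using that[of a b c d] adj2_cancel(1)[OF assms(1), of B] N by (simp add: mat2_SL2R)
qed

lemma minus_matrix_mult: "(- A :: real^2^2) ** B = - (A ** B)" "A ** (- B) = - (A ** B)"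
  by (simp_all add: vec_eq_iff matrix_matrix_mult_def sum_negf)

lemma mob_mat2: "mob (mat2 a b c d) z = (of_real a * z + of_real b) / (of_real c * z + of_real d)"
  by (simp add: mob_def)

lemma mob_minus: "mob (- A) z = mob A z"
proof -
  obtain a b c d where A: "A = mat2 a b c d" by (rule mat2_cases)
  have "mob (- A) z = (- (of_real a * z + of_real b)) / (- (of_real c * z + of_real d))"
    by (simp add: A uminus_mat2 mob_mat2)
  then show ?thesis by (simp only: minus_divide_divide A mob_mat2)
qed

lemma mob_denom_nonzero:
  assumes "A \<in> SL2R" "0 < Im z"
  shows "of_real (A$2$1) * z + of_real (A$2$2) \<noteq> 0"
proof
  assume eq: "of_real (A$2$1) * z + of_real (A$2$2) = 0"
  have "A$2$1 * Im z = 0" using arg_cong[OF eq, of Im] by simp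
  then have "A$2$1 = 0" using assms by simp
  with eq have "A$2$2 = 0" by simp
  with \<open>A$2$1 = 0\<close> assms(1) show False by (simp add: SL2R_def det_2)
qed

lemma Im_mob:
  assumes "A \<in> SL2R" "0 < Im z"
  shows "Im (mob A z) = Im z / (cmod (of_real (A$2$1) * z + of_real (A$2$2)))\<^sup>2"
proof -
  obtain a b c d where A: "A = mat2 a b c d" by (rule mat2_cases)
  have ad: "a * d = 1 + b * c" using assms(1) A by (simp add: mat2_SL2R)
  have "a * (d * Im z) = Im z + b * (c * Im z)"
    by (simp add: ad distrib_right flip: mult.assoc)
  then show ?thesis
    unfolding A mob_mat2 by (simp add: Im_divide cmod_power2 algebra_simps)
qed

lemma mob_upper: "A \<in> SL2R \<Longrightarrow> 0 < Im z \<Longrightarrow> 0 < Im (mob A z)"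
  using Im_mob mob_denom_nonzero by simp

lemma mob_1: "mob (mat 1) z = z"
  by (simp add: mat_1_mat2 mob_mat2)

lemma mob_mult:
  assumes "A \<in> SL2R" "B \<in> SL2R" "0 < Im z"
  shows "mob (A ** B) z = mob A (mob B z)"
proof -
  obtain a b c d where A: "A = mat2 a b c d" by (rule mat2_cases)
  obtain a' b' c' d' where B: "B = mat2 a' b' c' d'" by (rule mat2_cases)
  define w where "w = of_real c' * z + of_real d'"
  define v where "v = of_real a' * z + of_real b'"
  have w: "w \<noteq> 0" using mob_denom_nonzero[OF assms(2,3)] by (simp add: w_def B)
  have "mob A (mob B z) = (of_real a * (v / w) + of_real b) / (of_real c * (v / w) + of_real d)"
    by (simp add: A B mob_mat2 w_def v_def)
  also have "\<dots> = ((of_real a * v + of_real b * w) / w) / ((of_real c * v + of_real d * w) / w)"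
    using w by (simp add: add_divide_distrib)
  also have "\<dots> = (of_real a * v + of_real b * w) / (of_real c * v + of_real d * w)"
    using w by simp
  also have "\<dots> = mob (A ** B) z"
    by (simp add: A B mat2_mult mob_mat2 w_def v_def algebra_simps)
  finally show ?thesis by simp
qed

lemma mob_adj2:
  assumes "A \<in> SL2R" "0 < Im z"
  shows "mob (adj2 A) (mob A z) = z" "mob A (mob (adj2 A) z) = z"
  using mob_mult[OF adj2_SL2R[OF assms(1)] assms(1) assms(2)]
    mob_mult[OF assms(1) adj2_SL2R[OF assms(1)] assms(2)] adj2_mult[OF assms(1)]
  by (simp_all add: mob_1)

lemma mob_inj: "A \<in> SL2R \<Longrightarrow> 0 < Im z \<Longrightarrow> 0 < Im w \<Longrightarrow> mob A z = mob A w \<longleftrightarrow> z = w"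
  by (metis mob_adj2(1))

lemma continuous_on_mob: "A \<in> SL2R \<Longrightarrow> continuous_on upper_half_plane (mob A)"
  unfolding mob_def[abs_def]
  by (intro continuous_intros) (use mob_denom_nonzero in auto)

lemma mob_dist:
  assumes "A \<in> SL2R" "0 < Im z" "0 < Im w"
  shows "hyp_dist (mob A z) (mob A w) = hyp_dist z w"
proof -
  obtain a b c d where A: "A = mat2 a b c d" by (rule mat2_cases)
  define u where "u = of_real c * z + of_real d"
  define v where "v = of_real c * w + of_real d"
  have uv: "u \<noteq> 0" "v \<noteq> 0"
    using mob_denom_nonzero[OF assms(1,2)] mob_denom_nonzero[OF assms(1,3)]
    by (auto simp: u_def v_def A)
  have ad: "complex_of_real a * of_real d - of_real b * of_real c = 1"
    using assms(1) A by (simp add: mat2_SL2R flip: of_real_mult of_real_diff)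
  have "mob A z - mob A w = ((of_real a * of_real d - of_real b * of_real c) * (z - w)) / (u * v)"
    unfolding A mob_mat2 using uv
    by (simp add: divide_simps flip: u_def v_def) (simp add: u_def v_def algebra_simps)
  then have "mob A z - mob A w = (z - w) / (u * v)" by (simp add: ad)
  moreover have "Im (mob A z) = Im z / (cmod u)\<^sup>2" "Im (mob A w) = Im w / (cmod v)\<^sup>2"
    using Im_mob assms by (simp_all add: A u_def v_def)
  ultimately show ?thesis
    unfolding hyp_dist_def using uv
    by (simp add: norm_divide norm_mult power_divide power_mult_distrib)
qed

section \<open>Geodesic lines\<close>

lemma geod_upper: "A \<in> SL2R \<Longrightarrow> 0 < Im (geod A s)"
  by (simp add: geod_def mob_upper)

lemma geod_mult: "A \<in> SL2R \<Longrightarrow> B \<in> SL2R \<Longrightarrow> geod (A ** B) s = mob A (geod B s)"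
  by (simp add: geod_def mob_mult)

lemma geod_minus: "geod (- A) s = geod A s"
  by (simp add: geod_def mob_minus)

lemma Re_mob_imaginary:
  "Re (mob (mat2 a b c d) (\<i> * of_real y)) = (a * c * y\<^sup>2 + b * d) / (c\<^sup>2 * y\<^sup>2 + d\<^sup>2)"
  by (simp add: mob_mat2 Re_divide power_mult_distrib power2_eq_square algebra_simps)

lemma Im_mob_imaginary:
  assumes "a * d - b * c = 1"
  shows "Im (mob (mat2 a b c d) (\<i> * of_real y)) = y / (c\<^sup>2 * y\<^sup>2 + d\<^sup>2)"
proof -
  have "a * y * d - b * (c * y) = (a * d - b * c) * y" by (simp add: algebra_simps)
  then have "a * y * d - b * (c * y) = y" by (simp add: assms)
  then show ?thesis
    by (simp add: mob_mat2 Im_divide power_mult_distrib power2_eq_square algebra_simps)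
qed

lemma denom_imaginary_pos:
  fixes a b c d y :: real
  assumes "a * d - b * c = 1" "y > 0"
  shows "0 < c\<^sup>2 * y\<^sup>2 + d\<^sup>2"
proof (cases "c = 0")
  case True
  then show ?thesis using assms by auto
next
  case False
  then show ?thesis using assms by (simp add: add_pos_nonneg)
qed

lemma Re_geod_iff:
  fixes a b c d :: real
  assumes "a * d - b * c = 1"
  shows "Re (geod (mat2 a b c d) s) < 0 \<longleftrightarrow> a * c * (exp s)\<^sup>2 + b * d < 0"
    and "Re (geod (mat2 a b c d) s) = 0 \<longleftrightarrow> a * c * (exp s)\<^sup>2 + b * d = 0"
  using denom_imaginary_pos[OF assms, of "exp s"]
  by (simp_all add: geod_def Re_mob_imaginary divide_less_0_iff)

lemma left_side_iff:
  assumes "B \<in> SL2R" "0 < Im z"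
  shows "mob B z \<in> left_side B \<longleftrightarrow> Re z < 0"
  using assms by (auto simp: left_side_def image_iff) (metis mob_inj)

lemma left_side_mob_iff:
  assumes "g \<in> SL2R" "B \<in> SL2R" "0 < Im z"
  shows "mob g z \<in> left_side (g ** B) \<longleftrightarrow> z \<in> left_side B"
proof -
  define w where "w = mob (adj2 B) z"
  have w: "0 < Im w" "z = mob B w"
    using assms by (simp_all add: w_def mob_upper adj2_SL2R mob_adj2)
  show ?thesis
    using w assms left_side_iff[of "g ** B" w] left_side_iff[of B w]
    by (simp add: mob_mult SL2R_mult)
qed

text \<open>
  The sign of \<open>a c e\<^bsup>2s\<^esup> + b d\<close> tells on which side of the other line a line is at time \<open>s\<close>.  The
  expression is monotone in \<open>s\<close>, which is how the crossing arguments know that a line that reaches another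
  one passes to its other side.
\<close>

lemma geod_left_side_iff:
  assumes "B \<in> SL2R" "a * d - b * c = 1"
  shows "geod (B ** mat2 a b c d) s \<in> left_side B \<longleftrightarrow> a * c * (exp s)\<^sup>2 + b * d < 0"
  using assms left_side_iff[OF assms(1) geod_upper[of "mat2 a b c d" s]]
  by (simp add: geod_mult mat2_SL2R Re_geod_iff)

lemma mem_geod_iff:
  assumes "B \<in> SL2R" "0 < Im z"
  shows "mob B z \<in> range (geod B) \<longleftrightarrow> Re z = 0"
proof
  assume "mob B z \<in> range (geod B)"
  then obtain s where "mob B z = mob B (\<i> * of_real (exp s))" by (auto simp: geod_def)
  then have "z = \<i> * of_real (exp s)" using assms by (subst (asm) mob_inj) auto
  then show "Re z = 0" by simp
next
  assume "Re z = 0"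
  then have "z = \<i> * of_real (exp (ln (Im z)))" using assms by (simp add: complex_eq_iff)
  then show "mob B z \<in> range (geod B)" by (metis geod_def rangeI)
qed

lemma geod_mem_geod_iff:
  assumes "B \<in> SL2R" "a * d - b * c = 1"
  shows "geod (B ** mat2 a b c d) s \<in> range (geod B) \<longleftrightarrow> a * c * (exp s)\<^sup>2 + b * d = 0"
  using assms mem_geod_iff[OF assms(1) geod_upper[of "mat2 a b c d" s]]
  by (simp add: geod_mult mat2_SL2R Re_geod_iff)

lemma rev_geod_mat2: "rev_geod (A ** mat2 a b c d) = A ** mat2 b (- a) d (- c)"
  by (simp add: rev_geod_def mat2_mult flip: matrix_mul_assoc)

lemma rev_geod_SL2R: "A \<in> SL2R \<Longrightarrow> rev_geod A \<in> SL2R"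
  unfolding rev_geod_def by (intro SL2R_mult) (auto simp: mat2_SL2R)

lemma rev_rev_geod: "rev_geod (rev_geod A) = - A"
  by (cases A rule: mat2_cases) (simp add: rev_geod_def mat2_mult uminus_mat2)

lemma rev_geod_mult: "rev_geod (g ** A) = g ** rev_geod A"
  by (simp add: rev_geod_def matrix_mul_assoc)

lemma geod_rev: 
  assumes "A \<in> SL2R" shows "geod (rev_geod A) s = geod A (- s)"
proof -
  have "geod (mat2 0 (-1) 1 0) s = \<i> * of_real (exp (- s))"
    by (simp add: geod_def mob_mat2 exp_minus of_real_inverse divide_inverse)
  then show ?thesis
    using assms by (simp add: rev_geod_def geod_mult mat2_SL2R) (simp add: geod_def)
qed

text \<open>
  The matrices that send the vertical line to the same line as \<open>A\<close>: a shift of the parameter is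
  multiplication by a diagonal matrix, and the direction may be reversed.
\<close>

definition same_line :: "real^2^2 \<Rightarrow> real^2^2 \<Rightarrow> bool" where
  "same_line A B \<longleftrightarrow> (\<exists>a. a \<noteq> 0 \<and> (B = A ** mat2 a 0 0 (inverse a) \<or> B = rev_geod A ** mat2 a 0 0 (inverse a)))"

text \<open>
  The expression \<open>a c y\<^sup>2 + b d\<close> vanishes for two values of \<open>y\<^sup>2\<close>, so \<open>a c = b d = 0\<close>, and the
  quotient matrix is diagonal or antidiagonal.
\<close>

lemma same_line_two_points:
  assumes "A \<in> SL2R" "B \<in> SL2R" "s \<noteq> s'"
    and "geod B s \<in> range (geod A)" "geod B s' \<in> range (geod A)"
  shows "same_line A B"
proof -
  obtain a b c d where B: "B = A ** mat2 a b c d" and det: "a * d - b * c = 1"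
    using SL2R_factor[OF assms(1,2)] .
  have eqs: "a * c * (exp s)\<^sup>2 + b * d = 0" "a * c * (exp s')\<^sup>2 + b * d = 0"
    using assms(4,5) geod_mem_geod_iff[OF assms(1) det] by (simp_all add: B)
  have "a * c * (X - Y) = (a * c * X + b * d) - (a * c * Y + b * d)" for X Y
    by (simp add: algebra_simps)
  then have "a * c * ((exp s)\<^sup>2 - (exp s')\<^sup>2) = 0" by (simp only: eqs diff_self)
  moreover have "(exp s)\<^sup>2 - (exp s')\<^sup>2 \<noteq> 0" using assms(3) by (simp add: power2_eq_iff_nonneg)
  ultimately have ac: "a * c = 0" by simp
  with eqs have bd: "b * d = 0" by simp
  show ?thesis
  proof (cases "a = 0")
    case True
    then have "b * c = -1" using det by simp
    then have b: "b \<noteq> 0" by auto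
    then have "d = 0" "c = - inverse b" using bd \<open>b * c = -1\<close> by (auto simp: field_simps)
    then have "B = A ** (mat2 0 (-1) 1 0 ** mat2 (- inverse b) 0 0 (- b))" using B True by (simp add: mat2_mult)
    then have "B = rev_geod A ** mat2 (- inverse b) 0 0 (inverse (- inverse b))"
      by (simp add: rev_geod_def matrix_mul_assoc)
    then show ?thesis unfolding same_line_def using b by (metis inverse_nonzero_iff_nonzero neg_equal_0_iff_equal)
  next
    case False
    then have "c = 0" using ac by simp
    then have d: "d = inverse a" "b = 0" using det bd False by (auto simp: field_simps)
    then show ?thesis using B False \<open>c = 0\<close> by (auto simp: same_line_def)
  qed
qed

lemma geod_diag:
  assumes "A \<in> SL2R" "a \<noteq> 0"
  shows "geod (A ** mat2 a 0 0 (inverse a)) s = geod A (s + 2 * ln \<bar>a\<bar>)"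
proof -
  have "exp (2 * ln \<bar>a\<bar>) = a\<^sup>2" using assms(2) by (simp add: exp_double)
  then have "geod (mat2 a 0 0 (inverse a)) s = \<i> * of_real (exp (s + 2 * ln \<bar>a\<bar>))"
    by (simp add: geod_def mob_mat2 exp_add of_real_inverse divide_inverse power2_eq_square del: of_real_exp)
  then show ?thesis
    using assms by (simp add: geod_mult mat2_SL2R) (simp add: geod_def)
qed

lemma same_line_range:
  assumes "same_line A B" "A \<in> SL2R"
  shows "range (geod B) = range (geod A)"
proof -
  have *: "range (geod (A ** mat2 a 0 0 (inverse a))) = range (geod A)" if "A \<in> SL2R" "a \<noteq> 0" for A a
  proof -
    have "range (geod (A ** mat2 a 0 0 (inverse a))) = range (\<lambda>s. geod A (s + 2 * ln \<bar>a\<bar>))"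
      by (intro arg_cong[where f = range] ext geod_diag that)
    also have "\<dots> = geod A ` range (\<lambda>s. s + 2 * ln \<bar>a\<bar>)" by (simp only: image_image)
    also have "range (\<lambda>s::real. s + 2 * ln \<bar>a\<bar>) = UNIV"
      by (rule surjI[of _ "\<lambda>s. s - 2 * ln \<bar>a\<bar>"]) simp
    finally show ?thesis .
  qed
  have "range (geod (rev_geod A)) = range (\<lambda>s. geod A (- s))"
    by (intro arg_cong[where f = range] ext geod_rev assms)
  also have "\<dots> = geod A ` range uminus" by (simp only: image_image)
  also have "range (uminus :: real \<Rightarrow> real) = UNIV" by simp
  finally have "range (geod (rev_geod A)) = range (geod A)" .
  then show ?thesis
    using assms(1) *[OF assms(2)] *[OF rev_geod_SL2R[OF assms(2)]] unfolding same_line_def by metis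
qed

lemma same_line_euclidean:
  assumes "same_line A B" "same_line A C" "A \<in> SL2R"
  shows "same_line B C"
proof -
  have SL: "B \<in> SL2R" "C \<in> SL2R"
    using assms by (auto simp: same_line_def SL2R_mult rev_geod_SL2R mat2_SL2R)
  have "geod C s \<in> range (geod B)" for s
    using same_line_range[OF assms(1,3)] same_line_range[OF assms(2,3)] by blast
  then show ?thesis
    using SL same_line_two_points[of B C 0 1] by auto
qed

lemma geod_inj: "A \<in> SL2R \<Longrightarrow> geod A s = geod A t \<longleftrightarrow> s = t"
  by (auto simp: geod_def mob_inj)

text \<open>
  An isometry that shifts the line of \<open>A\<close> is conjugate by \<open>A\<close> to the diagonal matrix with entries
  \<open>e\<^bsup>len/2\<^esup>\<close> and \<open>e\<^bsup>-len/2\<^esup>\<close>, up to a common sign.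
\<close>

lemma trace_translation:
  assumes A: "A \<in> SL2R" and g: "g \<in> SL2R" and trans: "\<And>s. mob g (geod A s) = geod A (s + len)"
  shows "\<bar>trace g\<bar> = 2 * cosh (len / 2)"
proof -
  have gA: "geod (g ** A) s = geod A (s + len)" for s using trans A g by (simp add: geod_mult)
  have "same_line A (g ** A)"
    using A g gA by (intro same_line_two_points[of _ _ 0 1]) (auto simp: SL2R_mult)
  then obtain a where a: "a \<noteq> 0"
    "g ** A = A ** mat2 a 0 0 (inverse a) \<or> g ** A = rev_geod A ** mat2 a 0 0 (inverse a)"
    by (auto simp: same_line_def)
  have "g ** A \<noteq> rev_geod A ** mat2 a 0 0 (inverse a)"
  proof
    assume "g ** A = rev_geod A ** mat2 a 0 0 (inverse a)"
    then have "geod A (- (s + 2 * ln \<bar>a\<bar>)) = geod A (s + len)" for s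
      using gA[of s] a A by (simp add: geod_diag rev_geod_SL2R geod_rev)
    then have "- (s + 2 * ln \<bar>a\<bar>) = s + len" for s by (simp add: geod_inj[OF A])
    from this[of 0] this[of 1] show False by simp
  qed
  with a(2) have eq: "g ** A = A ** mat2 a 0 0 (inverse a)" by blast
  have "geod A (0 + 2 * ln \<bar>a\<bar>) = geod A (0 + len)"
    using gA[of 0] geod_diag[OF A a(1), of 0] by (simp add: eq)
  then have "2 * ln \<bar>a\<bar> = len" by (simp add: geod_inj[OF A])
  then have "len / 2 = ln \<bar>a\<bar>" by simp
  then have expl: "exp (len / 2) = \<bar>a\<bar>" using a(1) by simp
  have "trace g = trace ((g ** A) ** adj2 A)"
    by (simp only: matrix_mul_assoc[symmetric] adj2_mult[OF A] matrix_mul_rid)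
  also have "\<dots> = trace (adj2 A ** (A ** mat2 a 0 0 (inverse a)))" unfolding eq by (rule trace_mul_sym)
  also have "\<dots> = a + inverse a" by (simp add: adj2_cancel[OF A] trace_def sum_2)
  finally have "trace g = a + inverse a" .
  then have "\<bar>trace g\<bar> = \<bar>a\<bar> + inverse \<bar>a\<bar>"
  proof (cases "a > 0")
    case True
    then have "inverse a > 0" by simp
    with True \<open>trace g = a + inverse a\<close> show ?thesis by simp
  next
    case False
    then have "a < 0" "inverse a < 0" using a(1) by auto
    then have "a + inverse a < 0" by (rule add_neg_neg)
    with \<open>trace g = a + inverse a\<close> \<open>a < 0\<close> show ?thesis by simp
  qed
  then show ?thesis by (simp add: cosh_field_def exp_minus expl)
qed

section \<open>Ideal triangles\<close>

lemma cosh_hyp_dist: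
  assumes "0 < Im z" "0 < Im w"
  shows "cosh (hyp_dist z w) = 1 + (cmod (z - w))\<^sup>2 / (2 * Im z * Im w)"
  unfolding hyp_dist_def using assms by (intro cosh_arcosh_real) simp

lemma hyp_dist_nonneg:
  assumes "0 < Im z" "0 < Im w"
  shows "0 \<le> hyp_dist z w"
  unfolding hyp_dist_def using assms by (intro arcosh_nonneg_real) simp

text \<open>
  The forward end point of \<open>geod A\<close> is the direction of the first column of \<open>A\<close>.  Two lines
  share it iff the matrices differ by an upper triangular factor.
\<close>

lemma upper_of_parallel:
  assumes "A \<in> SL2R" "B \<in> SL2R" "A$1$1 * B$2$1 = A$2$1 * B$1$1"
  obtains a b where "a \<noteq> 0" "B = A ** mat2 a b 0 (inverse a)"
proof -
  obtain a b c d where A: "A = mat2 a b c d" by (rule mat2_cases)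
  obtain a' b' c' d' where B: "B = A ** mat2 a' b' c' d'" and det: "a' * d' - b' * c' = 1"
    using SL2R_factor[OF assms(1,2)] .
  have "a * (c * a' + d * c') = c * (a * a' + b * c')" using assms(3) by (simp add: A B mat2_mult)
  then have "(a * d - b * c) * c' = 0" by (simp add: algebra_simps)
  then have "c' = 0" using assms(1) by (simp add: A mat2_SL2R)
  then have "a' \<noteq> 0" "d' = inverse a'" using det inverse_unique[of a' d'] by auto
  then show ?thesis using that B \<open>c' = 0\<close> by blast
qed

text \<open>
  Take the first line to be the vertical one, which goes up to infinity.  If the lower left
  entry \<open>c\<close> of the quotient is not zero, then the second line comes down to the real axis, and
  the ratio of the heights alone makes the distance unbounded.
\<close>

lemma asymptotic_upper:
  assumes "A \<in> SL2R" "B \<in> SL2R" "asymptotic A B"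
  obtains a b where "a \<noteq> 0" "B = A ** mat2 a b 0 (inverse a)"
proof -
  obtain a b c d where B: "B = A ** mat2 a b c d" and det: "a * d - b * c = 1"
    using SL2R_factor[OF assms(1,2)] .
  obtain K where K: "\<And>s. s \<ge> 0 \<Longrightarrow> hyp_dist (geod A s) (geod B s) \<le> K"
    using assms(3) by (auto simp: asymptotic_def)
  have bound: "c\<^sup>2 * y\<^sup>2 / 2 \<le> cosh K" if "y \<ge> 1" for y :: real
  proof -
    define z where "z = \<i> * complex_of_real y"
    define w where "w = mob (mat2 a b c d) z"
    have z: "0 < Im z" and w: "0 < Im w"
      using that det by (simp_all add: z_def w_def mob_upper mat2_SL2R)
    have "geod (mat2 a b c d) (ln y) = w" "geod A (ln y) = mob A z"
      using that by (simp_all add: z_def w_def geod_def)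
    then have "hyp_dist z w = hyp_dist (geod A (ln y)) (geod B (ln y))"
      using z w assms(1) det by (simp add: B geod_mult mat2_SL2R mob_dist)
    also have "\<dots> \<le> K" using that by (intro K) simp
    finally have "cosh (hyp_dist z w) \<le> cosh K"
      using hyp_dist_nonneg[OF z w] by (subst cosh_real_nonneg_le_iff) auto
    then have le: "1 + (cmod (z - w))\<^sup>2 / (2 * Im z * Im w) \<le> cosh K" by (simp add: cosh_hyp_dist z w)
    have Imw: "Im w = y / (c\<^sup>2 * y\<^sup>2 + d\<^sup>2)"
      unfolding w_def z_def by (rule Im_mob_imaginary[OF det])
    have pos: "0 < c\<^sup>2 * y\<^sup>2 + d\<^sup>2" using that by (intro denom_imaginary_pos[OF det]) simp
    have "\<bar>Im (z - w)\<bar>\<^sup>2 \<le> (cmod (z - w))\<^sup>2" by (intro power_mono abs_Im_le_cmod) simp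
    then have "(y - Im w)\<^sup>2 \<le> (cmod (z - w))\<^sup>2" by (simp add: z_def)
    then have "(y - Im w)\<^sup>2 / (2 * y * Im w) \<le> (cmod (z - w))\<^sup>2 / (2 * Im z * Im w)"
      using that w by (simp add: z_def divide_right_mono)
    moreover have "y / (2 * Im w) \<le> 1 + (y - Im w)\<^sup>2 / (2 * y * Im w)"
    proof -
      have "1 + (y - Im w)\<^sup>2 / (2 * y * Im w) = y / (2 * Im w) + Im w / (2 * y)"
        using that w by (simp add: field_simps power2_eq_square)
      moreover have "Im w / (2 * y) \<ge> 0" using that w by simp
      ultimately show ?thesis by linarith
    qed
    moreover have "y / (2 * Im w) = (c\<^sup>2 * y\<^sup>2 + d\<^sup>2) / 2"
      using that pos by (simp add: Imw field_simps)
    moreover have "0 \<le> d\<^sup>2" by simp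
    ultimately show ?thesis using le by argo
  qed
  have "c = 0"
  proof (rule ccontr)
    assume c: "c \<noteq> 0"
    define y where "y = 1 + 2 * cosh K / c\<^sup>2"
    have c2: "0 < c\<^sup>2" using c by simp
    have y: "y > 1" using c2 by (simp add: y_def)
    have "y \<le> y\<^sup>2" using y by (simp add: power2_eq_square)
    then have "c\<^sup>2 * y\<^sup>2 / 2 \<ge> c\<^sup>2 * y / 2" by (intro divide_right_mono mult_left_mono) auto
    also have "c\<^sup>2 * y / 2 = c\<^sup>2 / 2 + cosh K" using c2 by (simp add: y_def field_simps)
    finally show False using bound[of y] y c2 by linarith
  qed
  then have "a \<noteq> 0" "d = inverse a" using det inverse_unique[of a d] by auto
  then show ?thesis using that B \<open>c = 0\<close> by blast
qed

text \<open>
  With \<open>b\<close> moved to the vertical line, the three asymptotic pairs leave only the vertex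
  \<open>x / y\<close> opposite to \<open>b\<close> and scaling factors free.  A common point of the left sides forces
  \<open>x / y < 0\<close>: this is where the counterclockwise order of the sides enters.
\<close>

lemma ideal_triangle_coordinates:
  assumes "ideal_triangle b r l"
  obtains x y k m where
    "r = b ** mat2 x (- inverse y) y 0" "l = b ** mat2 0 (k * x) m (k * y)"
    "k * x * m = -1" "x * y < 0" "y \<noteq> 0"
proof -
  have SL: "b \<in> SL2R" "r \<in> SL2R" "l \<in> SL2R"
    and asym: "asymptotic b (rev_geod r)" "asymptotic r (rev_geod l)" "asymptotic l (rev_geod b)"
    and ne: "tri_interior b r l \<noteq> {}"
    using assms by (auto simp: ideal_triangle_def)
  obtain a1 b1 where 1: "a1 \<noteq> 0" "rev_geod r = b ** mat2 a1 b1 0 (inverse a1)"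
    using asymptotic_upper[OF SL(1) rev_geod_SL2R[OF SL(2)] asym(1)] .
  define x where "x = - b1"
  define y where "y = - inverse a1"
  have "r = - rev_geod (rev_geod r)" by (simp add: rev_rev_geod)
  then have r: "r = b ** mat2 x (- inverse y) y 0"
    by (simp add: 1 rev_geod_mat2 x_def y_def uminus_mat2 flip: minus_matrix_mult(2))
  have y: "y \<noteq> 0" using 1 by (simp add: y_def)
  obtain a2 b2 where 2: "a2 \<noteq> 0" "rev_geod b = l ** mat2 a2 b2 0 (inverse a2)"
    using asymptotic_upper[OF SL(3) rev_geod_SL2R[OF SL(1)] asym(3)] .
  have "l = l ** (mat2 a2 b2 0 (inverse a2) ** mat2 (inverse a2) (- b2) 0 a2)"
    using 2(1) by (simp add: mat2_mult flip: mat_1_mat2)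
  also have "\<dots> = rev_geod b ** mat2 (inverse a2) (- b2) 0 a2"
    by (simp add: 2(2) matrix_mul_assoc)
  also have "\<dots> = b ** mat2 0 (- a2) (inverse a2) (- b2)"
    by (simp add: rev_geod_def mat2_mult flip: matrix_mul_assoc)
  finally have l: "l = b ** mat2 0 (- a2) (inverse a2) (- b2)" .
  obtain k b3 where 3: "k \<noteq> 0" "rev_geod l = r ** mat2 k b3 0 (inverse k)"
    using asymptotic_upper[OF SL(2) rev_geod_SL2R[OF SL(3)] asym(2)] .
  have "b ** mat2 (- a2) 0 (- b2) (- inverse a2) = rev_geod l"
    by (simp add: l rev_geod_mat2)
  also have "\<dots> = b ** (mat2 x (- inverse y) y 0 ** mat2 k b3 0 (inverse k))"
    by (simp add: 3 r matrix_mul_assoc)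
  finally have "adj2 b ** (b ** mat2 (- a2) 0 (- b2) (- inverse a2))
      = adj2 b ** (b ** (mat2 x (- inverse y) y 0 ** mat2 k b3 0 (inverse k)))" by simp
  then have "- a2 = x * k" "- b2 = y * k"
    by (simp_all add: adj2_cancel(2)[OF SL(1)] mat2_mult mat2_eq_iff)
  then have a2: "- a2 = k * x" "- b2 = k * y" by (simp_all add: mult.commute)
  have l': "l = b ** mat2 0 (k * x) (inverse a2) (k * y)" using l by (simp only: a2)
  have km: "k * x * inverse a2 = -1" using 2(1) by (simp flip: a2)
  obtain z where z: "z \<in> left_side b" "z \<in> left_side r"
    using ne by (auto simp: tri_interior_def)
  obtain z1 where z1: "0 < Im z1" "Re z1 < 0" "z = mob b z1" using z(1) by (auto simp: left_side_def)
  obtain z2 where z2: "0 < Im z2" "Re z2 < 0" "z = mob r z2" using z(2) by (auto simp: left_side_def)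
  have N: "mat2 x (- inverse y) y 0 \<in> SL2R" using y by (simp add: mat2_SL2R)
  have "mob b z1 = mob b (mob (mat2 x (- inverse y) y 0) z2)"
    using z1(3) z2(1,3) SL N by (simp add: r mob_mult)
  then have "z1 = mob (mat2 x (- inverse y) y 0) z2"
    using mob_inj[OF SL(1) z1(1) mob_upper[OF N z2(1)]] by simp
  also have "\<dots> = of_real (x / y) - of_real (inverse (y\<^sup>2)) / z2"
  proof -
    have "z2 \<noteq> 0" using z2(1) by auto
    then show ?thesis
      using y by (simp add: mob_mat2 diff_divide_distrib power2_eq_square) (simp add: field_simps)
  qed
  finally have "Re z1 = x / y - Re (of_real (inverse (y\<^sup>2)) / z2)" by simp
  moreover have Re_eq: "Re (of_real u / z2) = u * (Re z2 / (cmod z2)\<^sup>2)" for u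
    by (simp add: Re_divide cmod_power2)
  moreover have "inverse (y\<^sup>2) * (Re z2 / (cmod z2)\<^sup>2) \<le> 0"
    using z2(2) by (intro mult_nonneg_nonpos divide_nonpos_nonneg) auto
  ultimately have "x / y < 0" using z1(2) Re_eq[of "inverse (y\<^sup>2)"] by linarith
  then have "x * y < 0" by (auto simp: divide_less_0_iff mult_less_0_iff)
  then show ?thesis using that[OF r l' km _ y] by simp
qed

lemma quadratic_limit_nonpos:
  fixes P Q :: real
  assumes "y0 > 0" "\<And>y. 0 < y \<Longrightarrow> y < y0 \<Longrightarrow> P * y\<^sup>2 + Q < 0"
  shows "Q \<le> 0"
proof (rule tendsto_upperbound)
  have "((\<lambda>y. P * y\<^sup>2 + Q) \<longlongrightarrow> P * 0\<^sup>2 + Q) (at_right 0)" by (intro tendsto_intros)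
  then show "((\<lambda>y. P * y\<^sup>2 + Q) \<longlongrightarrow> Q) (at_right 0)" by simp
  show "\<forall>\<^sub>F y in at_right 0. P * y\<^sup>2 + Q \<le> 0"
    unfolding eventually_at_right_field using assms by (intro exI[of _ y0]) (auto intro: less_imp_le)
qed simp

text \<open>
  With \<open>x\<close> moved to the vertical line and \<open>A\<close> to \<open>mat2 a b c d\<close>, the backward end of the line
  is \<open>b / d\<close>.  It is not an end of \<open>x\<close>, since the line crosses \<open>x\<close>; being in the closure of
  the regions cut off by the two other sides, it is bounded from both sides by the opposite
  vertex \<open>X / Y\<close>.
\<close>

lemma starts_at_opposite_vertex:
  assumes tri: "ideal_triangle x left right" and A: "A \<in> SL2R"
    and inside: "geod A ` {..<t} \<subseteq> tri_interior x left right" and on: "geod A t \<in> range (geod x)"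
  obtains a b where "a \<noteq> 0" "rev_geod A = left ** mat2 a b 0 (inverse a)"
proof -
  obtain X Y k m where
    L: "left = x ** mat2 X (- inverse Y) Y 0" and R: "right = x ** mat2 0 (k * X) m (k * Y)"
    and km: "k * X * m = -1" and XY: "X * Y < 0" and Y: "Y \<noteq> 0"
    using ideal_triangle_coordinates[OF tri] .
  have SL: "x \<in> SL2R" "left \<in> SL2R" "right \<in> SL2R" using tri by (auto simp: ideal_triangle_def)
  have X: "X \<noteq> 0" using km by auto
  obtain a b c d where A': "A = x ** mat2 a b c d" and det: "a * d - b * c = 1"
    using SL2R_factor[OF SL(1) A] .
  have facL: "mat2 X (- inverse Y) Y 0 ** mat2 (c * inverse Y) (d * inverse Y) (X * c - Y * a) (X * d - Y * b)
        = mat2 a b c d"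
    using Y by (simp add: mat2_mult mat2_eq_iff field_simps)
  have mk: "m * k = - inverse X" using km X by (simp add: field_simps)
  have facR: "mat2 0 (k * X) m (k * Y) ** mat2 (k * (Y * a - X * c)) (k * (Y * b - X * d)) (- (m * a)) (- (m * b))
        = mat2 a b c d"
    unfolding mat2_mult mat2_eq_iff mat2_nth using km by (intro conjI; algebra)
  have AL: "A = left ** mat2 (c * inverse Y) (d * inverse Y) (X * c - Y * a) (X * d - Y * b)"
    unfolding A' L facL[symmetric] by (simp add: matrix_mul_assoc)
  have AR: "A = right ** mat2 (k * (Y * a - X * c)) (k * (Y * b - X * d)) (- (m * a)) (- (m * b))"
    unfolding A' R facR[symmetric] by (simp add: matrix_mul_assoc)
  have dL: "c * inverse Y * (X * d - Y * b) - d * inverse Y * (X * c - Y * a) = 1"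
    using det Y by (simp add: field_simps)
  have dR: "k * (Y * a - X * c) * - (m * b) - k * (Y * b - X * d) * - (m * a) = 1"
  proof -
    have "k * (Y * a - X * c) * - (m * b) - k * (Y * b - X * d) * - (m * a)
       = - (m * k * X) * (a * d - b * c)" by (simp add: algebra_simps)
    then show ?thesis using det mk X by simp
  qed
  have in3: "a * c * y\<^sup>2 + b * d < 0"
    "c * inverse Y * (X * c - Y * a) * y\<^sup>2 + d * inverse Y * (X * d - Y * b) < 0"
    "k * (Y * a - X * c) * - (m * a) * y\<^sup>2 + k * (Y * b - X * d) * - (m * b) < 0"
    if "0 < y" "y < exp t" for y
  proof -
    have "ln y < t" using that by (metis exp_less_cancel_iff exp_ln)
    then have "geod A (ln y) \<in> tri_interior x left right" using inside by auto
    then have "geod A (ln y) \<in> left_side x" "geod A (ln y) \<in> left_side left" "geod A (ln y) \<in> left_side right"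
      by (auto simp: tri_interior_def)
    then show "a * c * y\<^sup>2 + b * d < 0"
      "c * inverse Y * (X * c - Y * a) * y\<^sup>2 + d * inverse Y * (X * d - Y * b) < 0"
      "k * (Y * a - X * c) * - (m * a) * y\<^sup>2 + k * (Y * b - X * d) * - (m * b) < 0"
      using that(1) geod_left_side_iff[OF SL(1) det, of "ln y"] geod_left_side_iff[OF SL(2) dL, of "ln y"]
        geod_left_side_iff[OF SL(3) dR, of "ln y"]
      by (simp_all only: flip: A' AL AR) simp_all
  qed
  have at_t: "a * c * (exp t)\<^sup>2 + b * d = 0"
    using on geod_mem_geod_iff[OF SL(1) det] by (simp flip: A')
  have "a * c * (exp t / 2)\<^sup>2 + b * d < 0" by (intro in3(1)) simp_all
  then have "b * d < 0" using at_t by (simp add: power_divide)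
  \<comment> \<open>\<open>M = 0\<close> says that \<open>b / d = X / Y\<close>; the limits at the backward end give two inequalities
    for \<open>M\<close> that exclude each other otherwise.\<close>
  define M where "M = Y * b - X * d"
  have "d * inverse Y * (X * d - Y * b) \<le> 0"
    by (rule quadratic_limit_nonpos[OF _ in3(2)]) auto
  then have "d * Y * M \<ge> 0"
    using Y by (auto simp: M_def field_simps zero_le_mult_iff mult_le_0_iff divide_le_0_iff)
  have "k * (Y * b - X * d) * - (m * b) \<le> 0"
    by (rule quadratic_limit_nonpos[OF _ in3(3)]) auto
  moreover have "k * (Y * b - X * d) * - (m * b) = - (m * k) * (M * b)" by (simp add: M_def)
  ultimately have "inverse X * (M * b) \<le> 0" using mk by simp
  then have "X * (M * b) \<le> 0" using X by (auto simp: mult_le_0_iff)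
  with \<open>d * Y * M \<ge> 0\<close> have "(d * Y * M) * (X * (M * b)) \<le> 0" by (rule mult_nonneg_nonpos)
  moreover have "(d * Y * M) * (X * (M * b)) = (X * Y) * (b * d) * M\<^sup>2" by (simp add: power2_eq_square)
  moreover have "(X * Y) * (b * d) > 0" using XY \<open>b * d < 0\<close> by (rule mult_neg_neg)
  ultimately have "M = 0" by (metis mult_pos_pos not_le zero_less_power2)
  have "mat2 X (- inverse Y) Y 0 \<in> SL2R" "mat2 b (- a) d (- c) \<in> SL2R"
    using Y det by (simp_all add: mat2_SL2R algebra_simps)
  then obtain a' b' where 1: "a' \<noteq> 0" "mat2 b (- a) d (- c) = mat2 X (- inverse Y) Y 0 ** mat2 a' b' 0 (inverse a')"
    by (rule upper_of_parallel) (use \<open>M = 0\<close> M_def in simp)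
  have "rev_geod A = left ** mat2 a' b' 0 (inverse a')"
    unfolding A' rev_geod_mat2 1(2) L by (simp add: matrix_mul_assoc)
  with 1(1) show ?thesis by (rule that)
qed

text \<open>
  The line of \<open>A\<close> changes sides when it meets \<open>c\<close>.  As it is on the left of \<open>c\<close> before and on
  the left of \<open>B\<close> afterwards, \<open>B\<close> must run in the opposite direction.
\<close>

lemma crossing_reverses:
  assumes SL: "c \<in> SL2R" "A \<in> SL2R" and same: "same_line c B" and "s < t" "t < t'"
    and before: "geod A ` {s<..<t} \<subseteq> left_side c" and on: "geod A t \<in> range (geod c)"
    and after: "geod A ` {t<..<t'} \<subseteq> left_side B"
  obtains a where "a \<noteq> 0" "B = rev_geod c ** mat2 a 0 0 (inverse a)"
proof -
  obtain k where k: "k \<noteq> 0"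
    "B = c ** mat2 k 0 0 (inverse k) \<or> B = rev_geod c ** mat2 k 0 0 (inverse k)"
    using same by (auto simp: same_line_def)
  have False if B: "B = c ** mat2 k 0 0 (inverse k)"
  proof -
    obtain p q u v where A: "A = c ** mat2 p q u v" and det: "p * v - q * u = 1"
      using SL2R_factor[OF SL] .
    have "mat2 k 0 0 (inverse k) ** mat2 (inverse k * p) (inverse k * q) (k * u) (k * v) = mat2 p q u v"
      using k(1) by (simp add: mat2_mult mat2_eq_iff field_simps)
    then have AB: "A = B ** mat2 (inverse k * p) (inverse k * q) (k * u) (k * v)"
      by (simp add: A B flip: matrix_mul_assoc)
    have BSL: "B \<in> SL2R" using SL(1) k(1) by (simp add: B SL2R_mult mat2_SL2R)
    have det': "inverse k * p * (k * v) - inverse k * q * (k * u) = 1"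
      using det k(1) by (simp add: field_simps)
    have at: "p * u * (exp t)\<^sup>2 + q * v = 0"
      using on geod_mem_geod_iff[OF SL(1) det] by (simp flip: A)
    have "geod A ((s + t) / 2) \<in> left_side c" using before \<open>s < t\<close> by (intro subsetD[OF before] imageI) auto
    then have 1: "p * u * (exp ((s + t) / 2))\<^sup>2 + q * v < 0"
      using geod_left_side_iff[OF SL(1) det] by (simp flip: A)
    have "geod A ((t + t') / 2) \<in> left_side B" using after \<open>t < t'\<close> by (intro subsetD[OF after] imageI) auto
    then have "inverse k * p * (k * u) * (exp ((t + t') / 2))\<^sup>2 + inverse k * q * (k * v) < 0"
      using geod_left_side_iff[OF BSL det'] by (simp flip: AB)
    then have 2: "p * u * (exp ((t + t') / 2))\<^sup>2 + q * v < 0" using k(1) by (simp add: field_simps)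
    have e1: "(exp ((s + t) / 2))\<^sup>2 < (exp t)\<^sup>2" and e2: "(exp t)\<^sup>2 < (exp ((t + t') / 2))\<^sup>2"
      using \<open>s < t\<close> \<open>t < t'\<close> by (simp_all add: power_strict_mono)
    show False
    proof (cases "p * u \<ge> 0")
      case True
      then have "p * u * (exp t)\<^sup>2 \<le> p * u * (exp ((t + t') / 2))\<^sup>2" by (intro mult_left_mono less_imp_le[OF e2])
      then show False using 2 at by linarith
    next
      case False
      then have "p * u * (exp t)\<^sup>2 \<le> p * u * (exp ((s + t) / 2))\<^sup>2" by (intro mult_left_mono_neg less_imp_le[OF e1]) simp
      then show False using 1 at by linarith
    qed
  qed
  with k that show ?thesis by blast
qed

section \<open>The covering and its deck transformations\<close>

lemma cosh_ge_quadratic: "1 + x\<^sup>2 / 2 \<le> cosh (x::real)"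
proof -
  define f where "f n = (if even n then x ^ n /\<^sub>R fact n else 0)" for n
  have f: "f sums cosh x" unfolding f_def by (rule cosh_converges)
  have "sum f {..<3} \<le> suminf f"
    by (intro sum_le_suminf sums_summable[OF f]) (auto simp: f_def zero_le_even_power)
  also have "suminf f = cosh x" using f by (rule sums_unique[symmetric])
  finally have "sum f {..<3} \<le> cosh x" .
  moreover have "{..<3::nat} = {0, 1, 2}" by auto
  ultimately show ?thesis by (simp add: f_def field_simps)
qed

lemma hyp_dist_horizontal:
  assumes "y > 0"
  shows "hyp_dist (Complex x y) (Complex x' y) \<le> \<bar>x - x'\<bar> / y"
proof -
  let ?\<delta> = "hyp_dist (Complex x y) (Complex x' y)"
  have "(cmod (Complex x y - Complex x' y))\<^sup>2 = (x - x')\<^sup>2" by (simp add: cmod_power2)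
  then have "cosh ?\<delta> = 1 + (x - x')\<^sup>2 / (2 * y * y)" using assms by (simp add: cosh_hyp_dist)
  also have "\<dots> = 1 + (\<bar>x - x'\<bar> / y)\<^sup>2 / 2" by (simp add: power_divide power2_eq_square)
  also have "\<dots> \<le> cosh (\<bar>x - x'\<bar> / y)" by (rule cosh_ge_quadratic)
  finally have "cosh ?\<delta> \<le> cosh (\<bar>x - x'\<bar> / y)" .
  moreover have "0 \<le> ?\<delta>" using assms by (intro hyp_dist_nonneg) auto
  moreover have "0 \<le> \<bar>x - x'\<bar> / y" using assms by simp
  ultimately show ?thesis by (simp only: cosh_real_nonneg_le_iff)
qed

lemma eventually_hyp_dist_less:
  assumes "0 < Im z" "\<epsilon> > 0"
  shows "\<forall>\<^sub>F w in nhds z. 0 < Im w \<and> hyp_dist z w < \<epsilon>"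
proof -
  define q where "q w = 1 + (cmod (z - w))\<^sup>2 / (2 * Im z * Im w)" for w
  have "isCont q z" using assms unfolding q_def by (intro continuous_intros) auto
  then have "(q \<longlongrightarrow> q z) (nhds z)" by (simp add: isCont_def tendsto_at_iff_tendsto_nhds)
  moreover have "q z < cosh \<epsilon>" using assms cosh_real_strict_mono[of 0 \<epsilon>] by (simp add: q_def)
  ultimately have "\<forall>\<^sub>F w in nhds z. q w < cosh \<epsilon>" by (rule order_tendstoD)
  moreover have "\<forall>\<^sub>F w in nhds z. 0 < Im w"
    using assms(1) by (intro order_tendstoD(1)[of Im "Im z"] tendsto_intros) (auto simp: filterlim_ident)
  ultimately show ?thesis
  proof eventually_elim
    case (elim w)
    then have "cosh (hyp_dist z w) < cosh \<epsilon>" using assms by (simp add: cosh_hyp_dist q_def)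
    moreover have "0 \<le> hyp_dist z w" using elim assms by (intro hyp_dist_nonneg) auto
    ultimately show ?case using elim assms(2) by (simp add: cosh_real_nonneg_less_iff)
  qed
qed

text \<open>By the Lindelof property, countably many isolating neighbourhoods suffice.\<close>

lemma countable_if_isolated:
  fixes K :: "'a::second_countable_topology set"
  assumes "\<And>z. z \<in> K \<Longrightarrow> \<exists>T. open T \<and> T \<inter> K = {z}"
  shows "countable K"
proof -
  define \<F> where "\<F> = {T. open T \<and> (\<exists>z. T \<inter> K = {z})}"
  obtain \<G> where \<G>: "\<G> \<subseteq> \<F>" "countable \<G>" "\<Union>\<G> = \<Union>\<F>"
    using Lindelof[of \<F>] by (auto simp: \<F>_def)
  have "K \<subseteq> \<Union>\<F>" using assms by (fastforce simp: \<F>_def)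
  then have "K = (\<Union>T\<in>\<G>. T \<inter> K)" using \<G>(3) by auto
  also have "countable \<dots>"
  proof (rule countable_UN[OF \<G>(2)])
    fix T assume "T \<in> \<G>"
    then obtain z where "T \<inter> K = {z}" using \<G>(1) by (auto simp: \<F>_def)
    then show "countable (T \<inter> K)" by simp
  qed
  finally show ?thesis .
qed

lemma connected_upper_half_plane: "connected upper_half_plane"
  by (intro convex_connected convex_halfspace_Im_gt)

definition deck :: "(complex \<Rightarrow> 'a) \<Rightarrow> (real^2^2) set" where
  "deck p = {g \<in> SL2R. \<forall>u\<in>upper_half_plane. p (mob g u) = p u}"

lemma deck_SL2R: "g \<in> deck p \<Longrightarrow> g \<in> SL2R"
  by (simp add: deck_def)

lemma deck_mob: "g \<in> deck p \<Longrightarrow> 0 < Im u \<Longrightarrow> p (mob g u) = p u"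
  by (simp add: deck_def)

lemma deck_geod: "g \<in> deck p \<Longrightarrow> A \<in> SL2R \<Longrightarrow> p (geod (g ** A) s) = p (geod A s)"
  by (simp add: geod_mult deck_SL2R deck_mob geod_upper)

lemma continuous_on_geod: "A \<in> SL2R \<Longrightarrow> continuous_on X (geod A)"
  unfolding geod_def[abs_def]
  by (rule continuous_on_compose2[OF continuous_on_mob]) (auto intro!: continuous_intros)

locale hyperbolic_covering =
  fixes p :: "complex \<Rightarrow> 'a::t2_space" and X :: "'a set" and d :: "'a \<Rightarrow> 'a \<Rightarrow> real"
  assumes covering: "oriented_universal_covering p X d"
begin

lemma covering_p: "covering_space upper_half_plane p X"
  using covering by (simp add: oriented_universal_covering_def)

lemma p_mem: "0 < Im z \<Longrightarrow> p z \<in> X"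
  using covering_space_imp_surjective[OF covering_p] by blast

lemma continuous_p: "continuous_on upper_half_plane p"
  by (rule covering_space_imp_continuous[OF covering_p])

lemma local_isometry:
  assumes "0 < Im z"
  obtains \<epsilon> where "\<epsilon> > 0"
    "\<And>w w'. 0 < Im w \<Longrightarrow> 0 < Im w' \<Longrightarrow> hyp_dist z w < \<epsilon> \<Longrightarrow> hyp_dist z w' < \<epsilon> \<Longrightarrow> d (p w) (p w') = hyp_dist w w'"
  using covering assms unfolding oriented_universal_covering_def by (auto 0 4)

lemma deck_exists:
  assumes "0 < Im z" "0 < Im w" "p z = p w"
  obtains g where "g \<in> deck p" "mob g z = w"
proof -
  have "\<exists>A\<in>SL2R. mob A z = w \<and> (\<forall>u\<in>upper_half_plane. p (mob A u) = p u)"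
    using covering assms unfolding oriented_universal_covering_def by blast
  then show ?thesis using that by (auto simp: deck_def)
qed

text \<open>Both maps are lifts of \<open>p\<close> through \<open>p\<close> that agree at one point.\<close>

lemma deck_unique:
  assumes "g \<in> deck p" "h \<in> deck p" "0 < Im z" "mob g z = mob h z" "0 < Im u"
  shows "mob g u = mob h u"
  by (rule covering_space_lift_unique[OF covering_p assms(4) continuous_p _
        continuous_on_mob[OF deck_SL2R[OF assms(1)]] _ _ continuous_on_mob[OF deck_SL2R[OF assms(2)]] _ _
        connected_upper_half_plane])
     (use assms in \<open>auto simp: p_mem deck_SL2R mob_upper deck_mob\<close>)

text \<open>The map \<open>p\<close> is isometric near each point, so it is injective there and the fibres are discrete.\<close>

lemma countable_fibre: "countable {w. 0 < Im w \<and> p w = x}"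
proof (rule countable_if_isolated)
  fix z assume "z \<in> {w. 0 < Im w \<and> p w = x}"
  then have z: "0 < Im z" "p z = x" by auto
  obtain \<epsilon> where \<epsilon>: "\<epsilon> > 0"
    "\<And>w w'. 0 < Im w \<Longrightarrow> 0 < Im w' \<Longrightarrow> hyp_dist z w < \<epsilon> \<Longrightarrow> hyp_dist z w' < \<epsilon> \<Longrightarrow> d (p w) (p w') = hyp_dist w w'"
    using local_isometry[OF z(1)] by blast
  have zz: "hyp_dist z z = 0" by (simp add: hyp_dist_def)
  have "\<forall>\<^sub>F w in nhds z. 0 < Im w \<and> hyp_dist z w < \<epsilon>"
    using z \<epsilon> by (intro eventually_hyp_dist_less)
  then have "\<forall>\<^sub>F w in nhds z. w \<in> {w. 0 < Im w \<and> p w = x} \<longrightarrow> w = z"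
  proof eventually_elim
    case (elim w)
    show ?case
    proof
      assume "w \<in> {w. 0 < Im w \<and> p w = x}"
      then have "hyp_dist z w = d (p z) (p z)" using \<epsilon>(2)[of z w] elim z \<epsilon>(1) zz by simp
      also have "\<dots> = 0" using \<epsilon>(2)[of z z] z \<epsilon>(1) zz by simp
      finally have "cosh (hyp_dist z w) = 1" by simp
      then show "w = z" using elim z by (auto simp: cosh_hyp_dist)
    qed
  qed
  then obtain T where "open T" "z \<in> T" "\<forall>w\<in>T. w \<in> {w. 0 < Im w \<and> p w = x} \<longrightarrow> w = z"
    unfolding eventually_nhds by blast
  moreover have "z \<in> {w. 0 < Im w \<and> p w = x}" using z by simp
  ultimately show "\<exists>T. open T \<and> T \<inter> {w. 0 < Im w \<and> p w = x} = {z}" by blast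
qed

text \<open>
  Each point of \<open>geod B\<close> lies on a translate of \<open>geod A\<close>, a priori on one that varies with the
  point.  Since fibres are countable, there are only countably many translates, so two points
  of \<open>geod B\<close> lie on the same one, and two points determine the line.
\<close>

lemma line_covered_by_translates:
  assumes "A \<in> SL2R" "B \<in> SL2R" and sub: "projected p B \<subseteq> projected p A"
  obtains g where "g \<in> deck p" "same_line (g ** A) B"
proof -
  have "\<exists>g u. g \<in> deck p \<and> geod B s = mob g (geod A u)" for s
  proof -
    have "p (geod B s) \<in> projected p A" using sub by (auto simp: projected_def)
    then obtain u where "p (geod A u) = p (geod B s)" by (auto simp: projected_def)
    then show ?thesis using deck_exists[of "geod A u" "geod B s"] assms geod_upper by metis
  qed
  then obtain g u where g: "\<And>s. g s \<in> deck p" "\<And>s. geod B s = mob (g s) (geod A (u s))" by metis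
  define w where "w s = mob (g s) (geod A 0)" for s
  have "range w \<subseteq> {w. 0 < Im w \<and> p w = p (geod A 0)}"
    using g(1) assms(1) by (auto simp: w_def mob_upper deck_SL2R[OF g(1)] geod_upper deck_mob[OF g(1)])
  then have "countable (range w)" using countable_fibre countable_subset by blast
  then have "\<not> inj w" using countable_image_inj_on uncountable_UNIV_real by blast
  then obtain s s' where s: "s \<noteq> s'" "w s = w s'" by (auto simp: inj_def)
  have "mob (g s') z = mob (g s) z" if "0 < Im z" for z
    using deck_unique[OF g(1)[of s'] g(1)[of s] geod_upper[OF assms(1), of 0] _ that] s(2) by (simp add: w_def)
  then have "geod B s' = geod (g s ** A) (u s')" "geod B s = geod (g s ** A) (u s)"
    using assms g by (simp_all add: geod_mult deck_SL2R[OF g(1)] geod_upper)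
  then have "same_line (g s ** A) B"
    using assms s by (intro same_line_two_points[of _ _ s s']) (auto simp: SL2R_mult deck_SL2R[OF g(1)])
  with g(1) show ?thesis by (rule that)
qed

end

section \<open>Edges\<close>

text \<open>For these lines a decoration makes both horocycle times meaningful.\<close>

definition cusped :: "(complex \<Rightarrow> 'a::t2_space) \<Rightarrow> 'a set \<Rightarrow> real^2^2 \<Rightarrow> bool" where
  "cusped p V A \<longleftrightarrow> A \<in> SL2R \<and> (\<exists>v\<in>V. ends_at p (rev_geod A) v) \<and> (\<exists>w\<in>V. ends_at p A w)"

lemma cuspedD:
  assumes "cusped p V A"
  shows "A \<in> SL2R" "\<exists>w\<in>V. ends_at p A w" "cusped p V (rev_geod A)"
  using assms by (auto simp: cusped_def rev_geod_SL2R rev_rev_geod ends_at_def geod_minus)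

lemma ends_at_deck:
  assumes "g \<in> deck p" "A \<in> SL2R"
  shows "ends_at p (g ** A) v \<longleftrightarrow> ends_at p A v"
  using assms by (simp add: ends_at_def deck_geod)

lemma cusped_deck:
  assumes "g \<in> deck p" "A \<in> SL2R"
  shows "cusped p V (g ** A) \<longleftrightarrow> cusped p V A"
proof -
  have "g ** A \<in> SL2R" using assms by (simp add: SL2R_mult deck_SL2R[OF assms(1)])
  then show ?thesis
    using assms by (simp add: cusped_def rev_geod_mult ends_at_deck rev_geod_SL2R)
qed

lemma cusped_same_line:
  assumes "cusped p V A" "same_line A B"
  shows "cusped p V B"
proof -
  have ends: "ends_at p (A ** mat2 a 0 0 (inverse a)) v" if "ends_at p A v" "A \<in> SL2R" "a \<noteq> 0" for a v and A
  proof -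
    have "filterlim (\<lambda>s. s + 2 * ln \<bar>a\<bar>) at_top at_top"
      using filterlim_tendsto_add_at_top[OF tendsto_const[of "2 * ln \<bar>a\<bar>"] filterlim_ident]
      by (simp add: add.commute)
    then have "((\<lambda>s. p (geod A (s + 2 * ln \<bar>a\<bar>))) \<longlongrightarrow> v) at_top"
      using filterlim_compose[OF that(1)[unfolded ends_at_def]] by fastforce
    then show ?thesis using that by (simp add: ends_at_def geod_diag)
  qed
  have *: "cusped p V (A ** mat2 a 0 0 (inverse a))" if "cusped p V A" "a \<noteq> 0" for A a
  proof -
    have "rev_geod (A ** mat2 a 0 0 (inverse a)) = rev_geod A ** mat2 (inverse a) 0 0 (inverse (inverse a))"
      by (simp add: rev_geod_mat2) (simp add: rev_geod_def mat2_mult flip: matrix_mul_assoc)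
    moreover have "A ** mat2 a 0 0 (inverse a) \<in> SL2R" "rev_geod A \<in> SL2R"
      using that by (auto simp: cusped_def SL2R_mult mat2_SL2R rev_geod_SL2R)
    ultimately show ?thesis
      using that ends[of "rev_geod A" _ "inverse a"] ends[of A _ a]
      unfolding cusped_def by (metis inverse_nonzero_iff_nonzero)
  qed
  show ?thesis
    using assms(2) *[OF assms(1)] *[OF cuspedD(3)[OF assms(1)]] unfolding same_line_def by blast
qed

locale triangulated_surface = hyperbolic_covering p "S - V" d
  for S V :: "'a::t2_space set" and d :: "'a \<Rightarrow> 'a \<Rightarrow> real" and p :: "complex \<Rightarrow> 'a" +
  fixes E :: "'a set set"
  assumes triangulation: "ideal_triangulation p S V E"
begin

lemma edge_lift_translate:
  assumes "edge_lift p E B"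
  obtains A g where "cusped p V A" "inj (\<lambda>s. p (geod A s))" "projected p A = projected p B"
    "g \<in> deck p" "same_line (g ** A) B"
    "\<forall>C. edge_lift p E C \<longrightarrow> projected p C = projected p B \<longrightarrow> (\<exists>h\<in>deck p. same_line (h ** A) C)"
proof -
  have "projected p B \<in> E" using assms by (auto simp: edge_lift_def)
  then have "\<exists>A\<in>SL2R. projected p B = projected p A \<and> inj (\<lambda>s. p (geod A s)) \<and>
        (\<exists>v\<in>V. \<exists>w\<in>V. ends_at p (rev_geod A) v \<and> ends_at p A w)"
    using triangulation unfolding ideal_triangulation_def by blast
  then obtain A where A: "cusped p V A" "inj (\<lambda>s. p (geod A s))" "projected p A = projected p B"
    unfolding cusped_def by force
  have *: "\<exists>h\<in>deck p. same_line (h ** A) C" if "edge_lift p E C" "projected p C = projected p B" for C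
  proof -
    have "projected p C \<subseteq> projected p A" "C \<in> SL2R" using that A by (auto simp: edge_lift_def)
    then show ?thesis
      using line_covered_by_translates[OF cuspedD(1)[OF A(1)], of C] by blast
  qed
  then obtain g where "g \<in> deck p" "same_line (g ** A) B" using assms by blast
  with A * show ?thesis by (intro that) auto
qed

lemma edge_lift_cusped:
  assumes "edge_lift p E B"
  shows "cusped p V B"
proof -
  obtain A g where A: "cusped p V A" "g \<in> deck p" "same_line (g ** A) B"
    using edge_lift_translate[OF assms] .
  then have "cusped p V (g ** A)" using cusped_deck cuspedD(1) by blast
  then show ?thesis using A(3) by (rule cusped_same_line)
qed

text \<open>
  Edges are disjoint, so both lines are translates of the same line, by \<open>g\<close> and \<open>h\<close>.  The
  projection of that line is injective, so the common point comes from the same parameter on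
  both, hence \<open>g\<close> and \<open>h\<close> agree at a point and act in the same way.
\<close>

lemma edge_lifts_meeting:
  assumes B: "edge_lift p E B" and C: "edge_lift p E C"
    and z: "z \<in> range (geod B)" "z \<in> range (geod C)"
  shows "same_line B C"
proof -
  have SL: "B \<in> SL2R" "C \<in> SL2R" using B C by (auto simp: edge_lift_def)
  have "p z \<in> projected p B" "p z \<in> projected p C" using z by (auto simp: projected_def)
  moreover have "projected p B \<in> E" "projected p C \<in> E" "pairwise disjnt E"
    using B C triangulation by (auto simp: edge_lift_def ideal_triangulation_def)
  ultimately have "projected p C = projected p B"
    unfolding pairwise_def disjnt_def by blast
  obtain A g where A: "cusped p V A" "inj (\<lambda>s. p (geod A s))" "projected p A = projected p B"
    and g: "g \<in> deck p" "same_line (g ** A) B"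
    and lifts: "\<forall>C. edge_lift p E C \<longrightarrow> projected p C = projected p B \<longrightarrow> (\<exists>h\<in>deck p. same_line (h ** A) C)"
    using edge_lift_translate[OF B] .
  obtain h where h: "h \<in> deck p" "same_line (h ** A) C"
    using lifts C \<open>projected p C = projected p B\<close> by blast
  have ASL: "A \<in> SL2R" "g ** A \<in> SL2R" "h ** A \<in> SL2R"
    using A by (auto simp: cusped_def SL2R_mult deck_SL2R[OF g(1)] deck_SL2R[OF h(1)])
  obtain u where u: "z = geod (g ** A) u" using same_line_range[OF g(2) ASL(2)] z(1) by auto
  obtain v where v: "z = geod (h ** A) v" using same_line_range[OF h(2) ASL(3)] z(2) by auto
  have "p (geod A u) = p (geod A v)"
    using deck_geod[OF g(1) ASL(1), of u] deck_geod[OF h(1) ASL(1), of v] u v by simp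
  then have "u = v" using A(2) by (auto dest: injD)
  then have "mob g (geod A u) = mob h (geod A u)"
    using u v ASL(1) by (simp add: geod_mult deck_SL2R[OF g(1)] deck_SL2R[OF h(1)])
  then have "mob g w = mob h w" if "0 < Im w" for w
    using deck_unique[OF g(1) h(1) geod_upper[OF ASL(1)] _ that] by blast
  then have "geod (g ** A) s = geod (h ** A) s" for s
    using ASL(1) by (simp add: geod_mult deck_SL2R[OF g(1)] deck_SL2R[OF h(1)] geod_upper)
  then have "range (geod (g ** A)) = range (geod (h ** A))" by simp
  then have "same_line (g ** A) (h ** A)" 
    using ASL by (intro same_line_two_points[of _ _ 0 1]) auto
  then have "same_line (h ** A) B"
    using same_line_euclidean g(2) ASL by blast
  then show ?thesis using h(2) ASL same_line_euclidean by blast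
qed

end

section \<open>Horocycles\<close>

lemma mob_upper_triangular:
  assumes "a \<noteq> 0"
  shows "mob (mat2 a b 0 (inverse a)) z = of_real (a\<^sup>2) * z + of_real (a * b)"
  using assms by (simp add: mob_mat2 of_real_inverse divide_inverse power2_eq_square algebra_simps)

lemma upper_triangular_SL2R: "a \<noteq> 0 \<Longrightarrow> mat2 a b 0 (inverse a) \<in> SL2R"
  by (simp add: mat2_SL2R)

lemma finite_separation:
  fixes v :: "'a::t2_space"
  assumes "finite W" "v \<notin> W"
  obtains U U' where "open U" "open U'" "v \<in> U" "W \<subseteq> U'" "U \<inter> U' = {}"
proof -
  have "\<exists>U U'. open U \<and> open U' \<and> v \<in> U \<and> W \<subseteq> U' \<and> U \<inter> U' = {}"
    using assms
  proof (induction W)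
    case empty
    show ?case by (intro exI[of _ UNIV] exI[of _ "{}"]) auto
  next
    case (insert w W)
    then obtain U U' where 1: "open U" "open U'" "v \<in> U" "W \<subseteq> U'" "U \<inter> U' = {}" by auto
    obtain T T' where 2: "open T" "open T'" "v \<in> T" "w \<in> T'" "T \<inter> T' = {}"
      using hausdorff[of v w] insert.prems by auto
    show ?case using 1 2 by (intro exI[of _ "U \<inter> T"] exI[of _ "U' \<union> T'"]) auto
  qed
  then show ?thesis using that by blast
qed

text \<open>
  The minimality clause makes the translation length \<open>\<tau>\<close> unique; it determines \<open>t\<close> through
  \<open>\<rho> = \<tau> / e\<^sup>t\<close>.
\<close>

lemma horocycle_length_time:
  assumes "horocycle_length p A t \<rho>" "horocycle_length p A t' \<rho>"
  shows "t = t'"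
proof -
  obtain \<tau> where 1: "\<tau> > 0" "\<forall>z\<in>upper_half_plane. p (mob A (z + of_real \<tau>)) = p (mob A z)"
     "\<forall>\<sigma>. 0 < \<sigma> \<and> \<sigma> < \<tau> \<longrightarrow> (\<exists>z\<in>upper_half_plane. p (mob A (z + of_real \<sigma>)) \<noteq> p (mob A z))"
     "\<rho> = \<tau> / exp t"
    using assms(1) unfolding horocycle_length_def by blast
  obtain \<tau>' where 2: "\<tau>' > 0" "\<forall>z\<in>upper_half_plane. p (mob A (z + of_real \<tau>')) = p (mob A z)"
     "\<forall>\<sigma>. 0 < \<sigma> \<and> \<sigma> < \<tau>' \<longrightarrow> (\<exists>z\<in>upper_half_plane. p (mob A (z + of_real \<sigma>)) \<noteq> p (mob A z))"
     "\<rho> = \<tau>' / exp t'"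
    using assms(2) unfolding horocycle_length_def by blast
  have "\<not> \<tau> < \<tau>'" "\<not> \<tau>' < \<tau>" using 1(1,2,3) 2(1,2,3) by blast+
  then have "\<tau> = \<tau>'" by simp
  then have "exp t = exp t'" using 1(1,4) 2(4) by (simp add: field_simps)
  then show ?thesis by simp
qed

lemma horo_time_eq:
  assumes "ends_at p A v" "horocycle_length p A t (r v)"
  shows "horo_time p r A = t"
  unfolding horo_time_def
proof (rule the_equality)
  show "\<exists>v. ends_at p A v \<and> horocycle_length p A t (r v)" using assms by blast
  fix t' assume "\<exists>v. ends_at p A v \<and> horocycle_length p A t' (r v)"
  then obtain w where w: "ends_at p A w" "horocycle_length p A t' (r w)" by blast
  have "w = v" using w(1) assms(1) unfolding ends_at_def by (intro tendsto_unique[OF _ w(1)[unfolded ends_at_def]]) auto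
  then show "t' = t" using w(2) assms(2) horocycle_length_time by blast
qed

lemma horo_time_minus: "horo_time p r (- A) = horo_time p r A"
  by (simp add: horo_time_def ends_at_def geod_minus horocycle_length_def mob_minus)

lemma horo_time_deck:
  assumes "g \<in> deck p" "A \<in> SL2R"
  shows "horo_time p r (g ** A) = horo_time p r A"
proof -
  have "p (mob (g ** A) z) = p (mob A z)" if "0 < Im z" for z
    using that assms by (simp add: mob_mult deck_SL2R[OF assms(1)] mob_upper deck_mob[OF assms(1)])
  then have "horocycle_length p (g ** A) t \<rho> = horocycle_length p A t \<rho>" for t \<rho>
    unfolding horocycle_length_def by (simp cong: conj_cong)
  then show ?thesis by (simp add: horo_time_def ends_at_deck assms)
qed

text \<open>
  The upper triangular factor acts as \<open>z \<mapsto> a\<^sup>2 z + a b\<close>, so a translation by \<open>\<tau> / a\<^sup>2\<close> before it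
  is a translation by \<open>\<tau>\<close> after it.
\<close>

lemma horocycle_length_upper_triangular:
  assumes "A \<in> SL2R" "a \<noteq> 0" "horocycle_length p A t \<rho>"
  shows "horocycle_length p (A ** mat2 a b 0 (inverse a)) (t - 2 * ln \<bar>a\<bar>) \<rho>"
proof -
  obtain \<tau> where 1: "\<tau> > 0" "\<forall>z\<in>upper_half_plane. p (mob A (z + of_real \<tau>)) = p (mob A z)"
     "\<forall>\<sigma>. 0 < \<sigma> \<and> \<sigma> < \<tau> \<longrightarrow> (\<exists>z\<in>upper_half_plane. p (mob A (z + of_real \<sigma>)) \<noteq> p (mob A z))"
     "\<rho> = \<tau> / exp t"
    using assms(3) unfolding horocycle_length_def by blast
  let ?B = "A ** mat2 a b 0 (inverse a)"
  define f where "f z = of_real (a\<^sup>2) * z + complex_of_real (a * b)" for z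
  have B: "mob ?B z = mob A (f z)" if "0 < Im z" for z
    using that assms by (simp add: mob_mult upper_triangular_SL2R mob_upper_triangular f_def)
  have a2: "a\<^sup>2 > 0" using assms(2) by simp
  have shift: "f (z + of_real \<sigma>) = f z + of_real (a\<^sup>2 * \<sigma>)" for z \<sigma> by (simp add: f_def algebra_simps)
  have Imf: "0 < Im (f z) \<longleftrightarrow> 0 < Im z" for z
    using a2 by (simp add: f_def zero_less_mult_iff flip: of_real_power)
  show ?thesis
    unfolding horocycle_length_def
  proof (intro exI[of _ "\<tau> / a\<^sup>2"] conjI ballI allI impI)
    show "\<tau> / a\<^sup>2 > 0" using 1 a2 by simp
    show "p (mob ?B (z + of_real (\<tau> / a\<^sup>2))) = p (mob ?B z)" if "z \<in> upper_half_plane" for z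
    proof -
      have "mob ?B (z + of_real (\<tau> / a\<^sup>2)) = mob A (f z + of_real \<tau>)"
        using that a2 by (subst B) (simp_all only: shift, simp_all)
      then show ?thesis using 1(2) that Imf B by simp
    qed
    show "\<exists>z\<in>upper_half_plane. p (mob ?B (z + of_real \<sigma>)) \<noteq> p (mob ?B z)" if \<sigma>: "0 < \<sigma> \<and> \<sigma> < \<tau> / a\<^sup>2" for \<sigma>
    proof -
      have "0 < a\<^sup>2 * \<sigma> \<and> a\<^sup>2 * \<sigma> < \<tau>" using \<sigma> a2 by (simp add: field_simps)
      then obtain z where z: "0 < Im z" "p (mob A (z + of_real (a\<^sup>2 * \<sigma>))) \<noteq> p (mob A z)"
        using 1(3) by blast
      define w where "w = (z - of_real (a * b)) / of_real (a\<^sup>2)"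
      have "f w = z" using assms(2) by (simp add: f_def w_def)
      moreover have "0 < Im w" using z(1) Imf[of w] \<open>f w = z\<close> by simp
      ultimately show ?thesis
        using z(2) by (intro bexI[of _ w]) (simp_all add: B shift)
    qed
    have "exp (t - 2 * ln \<bar>a\<bar>) = exp t / a\<^sup>2" using assms(2) by (simp add: exp_diff exp_double)
    then show "\<rho> = \<tau> / a\<^sup>2 / exp (t - 2 * ln \<bar>a\<bar>)" using 1(4) a2 by simp
  qed
qed

text \<open>
  This turns local isometry, whose radius depends on the point, into a Lipschitz bound along a
  curve.
\<close>

lemma local_bound_imp_global_bound:
  fixes \<phi> :: "real \<Rightarrow> real \<Rightarrow> real"
  assumes "a \<le> b" and tri: "\<And>x y z. \<phi> x z \<le> \<phi> x y + \<phi> y z"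
    and loc: "\<And>x. \<exists>\<delta>>0. \<forall>u v. u \<le> x \<and> x \<le> v \<and> v - u < \<delta> \<longrightarrow> \<phi> u v \<le> K * (v - u)"
  shows "\<phi> a b \<le> K * (b - a)"
  using assms(1)
proof (induction rule: Bolzano)
  case (trans u v w)
  then show ?case using tri[of u w v] by (simp add: algebra_simps)
next
  case (local x)
  show ?case using loc by blast
qed

locale decorated_surface = triangulated_surface S V d p E
  for S V :: "'a::t2_space set" and d :: "'a \<Rightarrow> 'a \<Rightarrow> real" and p :: "complex \<Rightarrow> 'a" and E +
  fixes r :: "'a \<Rightarrow> real"
  assumes compact_S: "compact S" and finite_V: "finite V"
    and metric: "complete_hyperbolic_metric (S - V) d"
    and dec: "decoration p V r"
begin

lemma metric_space: "Metric_space (S - V) d"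
  and metric_topology: "Metric_space.mtopology (S - V) d = top_of_set (S - V)"
  using metric by (auto simp: complete_hyperbolic_metric_def)

lemma d_horizontal_le:
  assumes "A \<in> SL2R" "y > 0"
  shows "d (p (mob A (Complex 0 y))) (p (mob A (Complex h y))) \<le> \<bar>h\<bar> / y"
proof -
  interpret Metric_space "S - V" d by (rule metric_space)
  define f where "f x = p (mob A (Complex x y))" for x
  have f: "f x \<in> S - V" for x unfolding f_def using assms by (intro p_mem mob_upper) auto
  have le: "d (f a) (f b) \<le> 1 / y * (b - a)" if "a \<le> b" for a b
    using that
  proof (rule local_bound_imp_global_bound)
    show "d (f x) (f z) \<le> d (f x) (f y) + d (f y) (f z)" for x y z using f by (intro triangle)
    fix x
    have "0 < Im (mob A (Complex x y))" using assms by (simp add: mob_upper)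
    from local_isometry[OF this] obtain \<epsilon> where \<epsilon>: "\<epsilon> > 0"
      "\<And>w w'. 0 < Im w \<Longrightarrow> 0 < Im w' \<Longrightarrow> hyp_dist (mob A (Complex x y)) w < \<epsilon>
        \<Longrightarrow> hyp_dist (mob A (Complex x y)) w' < \<epsilon> \<Longrightarrow> d (p w) (p w') = hyp_dist w w'" by blast
    show "\<exists>\<delta>>0. \<forall>u v. u \<le> x \<and> x \<le> v \<and> v - u < \<delta> \<longrightarrow> d (f u) (f v) \<le> 1 / y * (v - u)"
    proof (intro exI[of _ "\<epsilon> * y"] conjI allI impI)
      show "\<epsilon> * y > 0" using \<epsilon> assms by simp
      fix u v assume uv: "u \<le> x \<and> x \<le> v \<and> v - u < \<epsilon> * y"
      have near: "hyp_dist (mob A (Complex x y)) (mob A (Complex w y)) < \<epsilon>" if "w \<in> {u, v}" for w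
      proof -
        have "hyp_dist (mob A (Complex x y)) (mob A (Complex w y)) \<le> \<bar>x - w\<bar> / y"
          using assms hyp_dist_horizontal by (simp add: mob_dist)
        also have "\<dots> < \<epsilon>" using uv that assms(2) by (auto simp: field_simps)
        finally show ?thesis .
      qed
      have "d (f u) (f v) = hyp_dist (mob A (Complex u y)) (mob A (Complex v y))"
        unfolding f_def using assms near by (intro \<epsilon>(2)) (auto simp: mob_upper)
      also have "\<dots> \<le> \<bar>u - v\<bar> / y" using assms hyp_dist_horizontal by (simp add: mob_dist)
      also have "\<dots> = 1 / y * (v - u)" using uv by simp
      finally show "d (f u) (f v) \<le> 1 / y * (v - u)" .
    qed
  qed
  show ?thesis
    using le[of 0 h] le[of h 0] commute[of "f 0" "f h"] by (cases "0 \<le> h") (auto simp: f_def)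
qed

text \<open>
  A point of the horocyclic segment at height \<open>e\<^sup>s\<close> has distance at most \<open>\<bar>h\<bar> / e\<^sup>s\<close> from \<open>geod A s\<close>.
  If these segments came back to \<open>y\<close>, then so would the line, which instead tends to \<open>v\<close>.
\<close>

lemma avoids_interior_points:
  assumes A: "A \<in> SL2R" and ends: "ends_at p A v" and v: "v \<in> V" and y: "y \<in> S - V"
  obtains O' where "open O'" "y \<in> O'"
    "\<forall>\<^sub>F s in at_top. \<forall>x. \<bar>x\<bar> \<le> h \<longrightarrow> p (mob A (Complex x (exp s))) \<notin> O'"
proof -
  interpret Metric_space "S - V" d by (rule metric_space)
  obtain W W' where W: "open W" "open W'" "y \<in> W" "v \<in> W'" "W \<inter> W' = {}"
    using hausdorff[of y v] v y by auto
  have "openin mtopology ((S - V) \<inter> W)" unfolding metric_topology using W(1) by auto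
  then obtain \<epsilon> where \<epsilon>: "\<epsilon> > 0" "mball y \<epsilon> \<subseteq> (S - V) \<inter> W"
    using W(3) y unfolding openin_mtopology by blast
  have "openin (top_of_set (S - V)) (mball y (\<epsilon> / 2))"
    unfolding metric_topology[symmetric] by (rule openin_mball)
  then obtain O' where O': "open O'" "mball y (\<epsilon> / 2) = (S - V) \<inter> O'" by (auto simp: openin_open)
  have "y \<in> O'" using O'(2) \<epsilon>(1) y centre_in_mball_iff[of y "\<epsilon> / 2"] by auto
  have "\<forall>\<^sub>F s in at_top. p (geod A s) \<in> W'"
    using ends W(2,4) unfolding ends_at_def by (rule topological_tendstoD)
  moreover have "\<forall>\<^sub>F s in at_top. \<bar>h\<bar> / exp s < \<epsilon> / 2"
  proof (rule order_tendstoD(2))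
    show "((\<lambda>s. \<bar>h\<bar> / exp s) \<longlongrightarrow> 0) at_top"
      by (rule real_tendsto_divide_at_top[OF tendsto_const exp_at_top])
  qed (use \<epsilon> in simp)
  ultimately have "\<forall>\<^sub>F s in at_top. \<forall>x. \<bar>x\<bar> \<le> h \<longrightarrow> p (mob A (Complex x (exp s))) \<notin> O'"
  proof eventually_elim
    case (elim s)
    show ?case
    proof (intro allI impI notI)
      fix x assume x: "\<bar>x\<bar> \<le> h" and mem: "p (mob A (Complex x (exp s))) \<in> O'"
      define a where "a = p (mob A (Complex 0 (exp s)))"
      define b where "b = p (mob A (Complex x (exp s)))"
      have ab: "a \<in> S - V" "b \<in> S - V" unfolding a_def b_def using A by (intro p_mem mob_upper; simp)+
      have "Complex 0 (exp s) = \<i> * of_real (exp s)" by (simp add: complex_eq_iff)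
      then have "a = p (geod A s)" by (simp add: a_def geod_def)
      then have "a \<notin> W" using elim(1) W(5) by auto
      have "d a b \<le> \<bar>x\<bar> / exp s" unfolding a_def b_def using A by (intro d_horizontal_le) auto
      also have "\<dots> \<le> \<bar>h\<bar> / exp s" using x by (intro divide_right_mono) auto
      finally have "d a b < \<epsilon> / 2" using elim(2) by linarith
      moreover have "b \<in> mball y (\<epsilon> / 2)" using O'(2) mem ab by (auto simp: b_def)
      then have "d y b < \<epsilon> / 2" by auto
      ultimately have "d y a < \<epsilon>" using triangle[of y b a] commute[of a b] ab y by simp
      then have "a \<in> mball y \<epsilon>" using y ab by auto
      then show False using \<epsilon>(2) \<open>a \<notin> W\<close> by blast
    qed
  qed
  with O'(1) \<open>y \<in> O'\<close> show ?thesis by (rule that)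
qed

text \<open>
  The distance \<open>d\<close> does not describe the topology of \<open>S\<close> at the punctures, so the limit of the
  shifted line cannot be read off from its distance to the original one.  By compactness of \<open>S\<close>,
  the segments that join the two lines at height \<open>e\<^sup>s\<close> are eventually contained in a
  neighbourhood of \<open>V\<close>.  This is taken as the disjoint union of a neighbourhood of \<open>v\<close> and one
  of the other punctures; a segment is connected and starts in the former, hence stays there.
\<close>

lemma horizontal_shift_tendsto:
  assumes A: "A \<in> SL2R" and ends: "ends_at p A v" and v: "v \<in> V"
  shows "((\<lambda>s. p (mob A (Complex h (exp s)))) \<longlongrightarrow> v) at_top"
proof (rule topological_tendstoI)
  fix G assume G: "open G" "v \<in> G"
  obtain U U' where U: "open U" "open U'" "v \<in> U" "V - {v} \<subseteq> U'" "U \<inter> U' = {}"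
    using finite_separation[of "V - {v}" v] finite_V by blast
  define C where "C = S - (U \<inter> G) - U'"
  have "compact C" unfolding C_def Diff_eq using compact_S U G
    by (intro compact_Int_closed) (auto simp: closed_Compl)
  define good where "good y T \<longleftrightarrow> open T \<and> y \<in> T \<and>
      (\<forall>\<^sub>F s in at_top. \<forall>x. \<bar>x\<bar> \<le> \<bar>h\<bar> \<longrightarrow> p (mob A (Complex x (exp s))) \<notin> T)" for y T
  have "\<exists>T. good y T" if "y \<in> C" for y
  proof -
    have "y \<in> S - V" using that U G by (auto simp: C_def)
    then obtain T where "open T" "y \<in> T"
      "\<forall>\<^sub>F s in at_top. \<forall>x. \<bar>x\<bar> \<le> \<bar>h\<bar> \<longrightarrow> p (mob A (Complex x (exp s))) \<notin> T"
      by (rule avoids_interior_points[OF A ends v])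
    then show ?thesis unfolding good_def by blast
  qed
  then obtain O' where "\<forall>y\<in>C. good y (O' y)" by metis
  then have O': "\<And>y. y \<in> C \<Longrightarrow> open (O' y)" "\<And>y. y \<in> C \<Longrightarrow> y \<in> O' y"
    "\<And>y. y \<in> C \<Longrightarrow> \<forall>\<^sub>F s in at_top. \<forall>x. \<bar>x\<bar> \<le> \<bar>h\<bar> \<longrightarrow> p (mob A (Complex x (exp s))) \<notin> O' y"
    by (simp_all add: good_def)
  have "C \<subseteq> (\<Union>y\<in>C. O' y)" using O'(2) by blast
  then obtain D where D: "D \<subseteq> C" "finite D" "C \<subseteq> (\<Union>y\<in>D. O' y)"
    using compactE_image[OF \<open>compact C\<close>, of C O'] O'(1) by blast
  have "\<forall>\<^sub>F s in at_top. \<forall>y\<in>D. \<forall>x. \<bar>x\<bar> \<le> \<bar>h\<bar> \<longrightarrow> p (mob A (Complex x (exp s))) \<notin> O' y"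
    using D(1,2) O'(3) by (intro eventually_ball_finite) auto
  moreover have "\<forall>\<^sub>F s in at_top. p (geod A s) \<in> U \<inter> G"
    using ends U G unfolding ends_at_def by (intro topological_tendstoD) auto
  ultimately show "\<forall>\<^sub>F s in at_top. p (mob A (Complex h (exp s))) \<in> G"
  proof eventually_elim
    case (elim s)
    define f where "f x = p (mob A (Complex x (exp s)))" for x
    define F where "F = f ` closed_segment 0 h"
    have "continuous_on (closed_segment 0 h) f"
      unfolding f_def
      by (rule continuous_on_compose2[OF continuous_p], rule continuous_on_compose2[OF continuous_on_mob[OF A]])
         (auto intro!: continuous_intros mob_upper A)
    then have "connected F" unfolding F_def by (intro connected_continuous_image) auto
    moreover have "F \<subseteq> (U \<inter> G) \<union> U'"
    proof
      fix a assume "a \<in> F"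
      then obtain x where x: "x \<in> closed_segment 0 h" "a = f x" by (auto simp: F_def)
      then have "\<bar>x\<bar> \<le> \<bar>h\<bar>" by (auto simp: closed_segment_eq_real_ivl split: if_splits)
      then have "a \<notin> (\<Union>y\<in>D. O' y)" using elim(1) x(2) by (auto simp: f_def)
      moreover have "a \<in> S" using p_mem[of "mob A (Complex x (exp s))"] A x(2) by (auto simp: f_def mob_upper)
      ultimately show "a \<in> (U \<inter> G) \<union> U'" using D(3) by (auto simp: C_def)
    qed
    moreover have "Complex 0 (exp s) = \<i> * of_real (exp s)" by (simp add: complex_eq_iff)
    then have "f 0 = p (geod A s)" by (simp add: f_def geod_def)
    then have "f 0 \<in> U \<inter> G" using elim(2) by simp
    moreover have "f 0 \<in> F" unfolding F_def by (intro imageI) simp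
    ultimately have "F \<inter> U' = {}"
      using connectedD[of F "U \<inter> G" U'] U G by blast
    then have "f h \<in> G" using \<open>F \<subseteq> (U \<inter> G) \<union> U'\<close> by (auto simp: F_def)
    then show ?case by (simp add: f_def)
  qed
qed

lemma ends_at_upper_triangular:
  assumes "A \<in> SL2R" "a \<noteq> 0" "ends_at p A v" "v \<in> V"
  shows "ends_at p (A ** mat2 a b 0 (inverse a)) v"
proof -
  have eq: "geod (A ** mat2 a b 0 (inverse a)) s = mob A (Complex (a * b) (exp (s + 2 * ln \<bar>a\<bar>)))" for s
  proof -
    have "exp (s + 2 * ln \<bar>a\<bar>) = a\<^sup>2 * exp s" using assms(2) by (simp add: exp_add exp_double)
    then have "Complex (a * b) (exp (s + 2 * ln \<bar>a\<bar>)) = of_real (a\<^sup>2) * (\<i> * of_real (exp s)) + of_real (a * b)"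
      by (simp add: complex_eq_iff flip: of_real_power)
    then show ?thesis
      using assms by (simp add: geod_mult upper_triangular_SL2R) (simp add: geod_def mob_upper_triangular)
  qed
  have "filterlim (\<lambda>s. s + 2 * ln \<bar>a\<bar>) at_top at_top"
    using filterlim_tendsto_add_at_top[OF tendsto_const[of "2 * ln \<bar>a\<bar>"] filterlim_ident]
    by (simp add: add.commute)
  from filterlim_compose[OF horizontal_shift_tendsto[OF assms(1,3,4)] this]
  show ?thesis by (simp add: ends_at_def eq)
qed

lemma horo_time_upper_triangular:
  assumes "A \<in> SL2R" "a \<noteq> 0" "ends_at p A v" "v \<in> V"
  shows "horo_time p r (A ** mat2 a b 0 (inverse a)) = horo_time p r A - 2 * ln \<bar>a\<bar>"
proof -
  obtain t where t: "horocycle_length p A t (r v)"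
    using dec assms unfolding decoration_def by blast
  then show ?thesis
    using horo_time_eq[where r = r, OF assms(3) t]
      horo_time_eq[where r = r, OF ends_at_upper_triangular[OF assms] horocycle_length_upper_triangular[OF assms(1,2) t]]
    by simp
qed

end

section \<open>Frames of decorated lines\<close>

text \<open>
  A matrix in \<open>SL2R\<close> is determined by its Moebius transformation, and the vector of a horocycle
  by the horocycle, only up to sign.
\<close>

definition pm_eq :: "'a::group_add \<Rightarrow> 'a \<Rightarrow> bool" where
  "pm_eq x y \<longleftrightarrow> x = y \<or> x = - y"

lemma pm_eq_refl: "pm_eq x x"
  by (simp add: pm_eq_def)

lemma pm_eq_sym: "pm_eq x y \<Longrightarrow> pm_eq y x"
  by (auto simp: pm_eq_def)

lemma pm_eq_trans [trans]: "pm_eq x y \<Longrightarrow> pm_eq y z \<Longrightarrow> pm_eq x z"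
  by (auto simp: pm_eq_def)

lemma pm_eq_mult:
  fixes A B C :: "real^2^2"
  shows "pm_eq A B \<Longrightarrow> pm_eq (A ** C) (B ** C)" "pm_eq A B \<Longrightarrow> pm_eq (C ** A) (C ** B)"
  by (auto simp: pm_eq_def minus_matrix_mult)

lemma pm_eq_mult_vec:
  fixes A B :: "real^2^2"
  assumes "pm_eq A B"
  shows "pm_eq (A *v x) (B *v x)"
proof -
  have "(- B) *v x = - (B *v x)"
    by (simp add: vec_eq_iff matrix_vector_mult_def sum_negf)
  then show ?thesis using assms by (auto simp: pm_eq_def)
qed

definition cross2 :: "real^2 \<Rightarrow> real^2 \<Rightarrow> real" where
  "cross2 v w = v$1 * w$2 - v$2 * w$1"

lemma cross2_pm: "pm_eq v v' \<Longrightarrow> pm_eq w w' \<Longrightarrow> \<bar>cross2 v w\<bar> = \<bar>cross2 v' w'\<bar>"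
  by (auto simp: pm_eq_def cross2_def abs_minus_commute)

lemma cross2_matrix: "cross2 (A *v v) (A *v w) = det A * cross2 v w"
  by (cases A rule: mat2_cases)
     (simp add: cross2_def matrix_vector_mult_def sum_2 det_mat2 algebra_simps)

definition matrix_chain :: "(nat \<Rightarrow> real^2^2) \<Rightarrow> nat \<Rightarrow> nat \<Rightarrow> real^2^2" where
  "matrix_chain M i n = foldr (\<lambda>k P. M k ** P) [i..<n] (mat 1)"

lemma matrix_chain_Suc:
  assumes "i \<le> n"
  shows "matrix_chain M i (Suc n) = matrix_chain M i n ** M n"
proof -
  have *: "foldr (\<lambda>k P. M k ** P) ks Q = foldr (\<lambda>k P. M k ** P) ks (mat 1) ** Q" for ks Q
    by (induction ks) (simp_all add: matrix_mul_lid matrix_mul_assoc)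
  show ?thesis
    using assms *[of "[i..<n]" "M n"] by (simp add: matrix_chain_def matrix_mul_rid)
qed

lemma scaleR_matrix_mult:
  fixes A B :: "real^2^2"
  shows "(a *\<^sub>R A) ** B = a *\<^sub>R (A ** B)" "A ** (a *\<^sub>R B) = a *\<^sub>R (A ** B)"
  by (simp_all add: vec_eq_iff matrix_matrix_mult_def sum_2 algebra_simps)

lemma scaleR_matrix_vector:
  fixes A :: "real^2^2"
  shows "(a *\<^sub>R A) *v x = a *\<^sub>R (A *v x)" "A *v (a *\<^sub>R x) = a *\<^sub>R (A *v x)"
  by (simp_all add: vec_eq_iff matrix_vector_mult_def sum_2 algebra_simps)

lemma pm_chain:
  fixes F M :: "nat \<Rightarrow> real^2^2"
  assumes "i \<le> n" "\<And>k. i \<le> k \<Longrightarrow> k < n \<Longrightarrow> pm_eq (F (Suc k)) (F k ** ((1 / \<mu> k) *\<^sub>R M k))"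
  shows "pm_eq (F n) (F i ** ((1 / (\<Prod>k=i..<n. \<mu> k)) *\<^sub>R matrix_chain M i n))"
  using assms
proof (induction n rule: dec_induct)
  case base
  show ?case by (simp add: matrix_chain_def pm_eq_refl matrix_mul_rid)
next
  case (step n)
  let ?Q = "(1 / (\<Prod>k=i..<n. \<mu> k)) *\<^sub>R matrix_chain M i n"
  have "pm_eq (F n) (F i ** ?Q)" using step by simp
  from pm_eq_mult(1)[OF this]
  have "pm_eq (F n ** ((1 / \<mu> n) *\<^sub>R M n)) (F i ** ?Q ** ((1 / \<mu> n) *\<^sub>R M n))" .
  moreover have "pm_eq (F (Suc n)) (F n ** ((1 / \<mu> n) *\<^sub>R M n))" using step by simp
  ultimately have "pm_eq (F (Suc n)) (F i ** ?Q ** ((1 / \<mu> n) *\<^sub>R M n))"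
    by (rule pm_eq_trans[rotated])
  also have "F i ** ?Q ** ((1 / \<mu> n) *\<^sub>R M n)
      = F i ** ((1 / (\<Prod>k=i..<Suc n. \<mu> k)) *\<^sub>R matrix_chain M i (Suc n))"
    using step(1) by (simp add: matrix_chain_Suc scaleR_matrix_mult matrix_mul_assoc)
  finally show ?case .
qed

definition nonneg_matrix :: "real^2^2 \<Rightarrow> bool" where
  "nonneg_matrix A \<longleftrightarrow> (\<forall>i j. 0 \<le> A$i$j)"

lemma nonneg_matrix_chain:
  assumes "\<And>k. nonneg_matrix (M k)"
  shows "nonneg_matrix (matrix_chain M i n)"
proof -
  have "nonneg_matrix (foldr (\<lambda>k P. M k ** P) ks (mat 1))" for ks
  proof (induction ks)
    case Nil
    show ?case by (simp add: nonneg_matrix_def mat_def)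
  next
    case (Cons k ks)
    then show ?case
      using assms[of k] by (auto simp: nonneg_matrix_def matrix_matrix_mult_def intro!: sum_nonneg)
  qed
  then show ?thesis by (simp add: matrix_chain_def)
qed

lemma prod_shift: "(\<Prod>k=1..n. f (Suc k)) * f 1 = (\<Prod>k=1..n. f k) * (f (Suc n) :: 'a::comm_monoid_mult)"
proof (induction n)
  case (Suc n)
  have "(\<Prod>k=1..Suc n. f (Suc k)) * f 1 = (\<Prod>k=1..n. f (Suc k)) * f 1 * f (Suc (Suc n))"
    by (simp add: ac_simps)
  also have "\<dots> = (\<Prod>k=1..Suc n. f k) * f (Suc (Suc n))"
    unfolding Suc.IH by (simp add: ac_simps)
  finally show ?case .
qed simp

context decorated_surface
begin

definition hscale :: "real^2^2 \<Rightarrow> real" where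
  "hscale A = exp (horo_time p r A / 2)"

text \<open>
  The columns are \<open>hvec (rev_geod A)\<close> and \<open>- hvec A\<close>: the backward end, which is on the left when
  \<open>A\<close> is crossed from its right to its left, comes first, and the sign makes the determinant
  positive.
\<close>

definition frame :: "real^2^2 \<Rightarrow> real^2^2" where
  "frame A = A ** mat2 0 (- hscale A) (hscale (rev_geod A)) 0"

definition hvec :: "real^2^2 \<Rightarrow> real^2" where
  "hvec A = hscale A *\<^sub>R (A *v vector [1, 0])"

abbreviation lam :: "real^2^2 \<Rightarrow> real" where
  "lam A \<equiv> lambda_arc p r A"

lemma hscale_pos: "hscale A > 0"
  by (simp add: hscale_def)

lemma lam_pos: "lam A > 0"
  by (simp add: lambda_arc_def)

lemma lam_eq: "lam A = hscale A * hscale (rev_geod A)"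
  by (simp add: lambda_arc_def signed_length_def hscale_def add_divide_distrib flip: exp_add)

lemma hscale_minus: "hscale (- A) = hscale A"
  by (simp add: hscale_def horo_time_minus)

lemma lam_rev: "lam (rev_geod A) = lam A"
  by (simp add: lam_eq rev_rev_geod hscale_minus)

lemma hscale_deck: "g \<in> deck p \<Longrightarrow> A \<in> SL2R \<Longrightarrow> hscale (g ** A) = hscale A"
  by (simp add: hscale_def horo_time_deck)

lemma lam_deck: "g \<in> deck p \<Longrightarrow> A \<in> SL2R \<Longrightarrow> lam (g ** A) = lam A"
  by (simp add: lam_eq rev_geod_mult hscale_deck rev_geod_SL2R)

lemma frame_deck: "g \<in> deck p \<Longrightarrow> A \<in> SL2R \<Longrightarrow> frame (g ** A) = g ** frame A"
  by (simp add: frame_def hscale_deck rev_geod_mult rev_geod_SL2R matrix_mul_assoc)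

lemma det_frame: "A \<in> SL2R \<Longrightarrow> det (frame A) = lam A"
  by (simp add: frame_def det_mul SL2R_def det_mat2 lam_eq)

lemma hscale_upper_triangular:
  assumes "cusped p V A" "a \<noteq> 0" "B = A ** mat2 a b 0 (inverse a)"
  shows "hscale B = hscale A / \<bar>a\<bar>"
proof -
  obtain v where "v \<in> V" "ends_at p A v" using assms(1) by (auto simp: cusped_def)
  then have "horo_time p r B = horo_time p r A - 2 * ln \<bar>a\<bar>"
    using assms cuspedD(1) horo_time_upper_triangular by blast
  then show ?thesis using assms(2) by (simp add: hscale_def diff_divide_distrib exp_diff)
qed

lemma hvec_upper_triangular:
  assumes "cusped p V A" "a \<noteq> 0" "B = A ** mat2 a b 0 (inverse a)"
  shows "pm_eq (hvec B) (hvec A)"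
proof -
  have "B *v vector [1, 0] = A *v (mat2 a b 0 (inverse a) *v vector [1, 0])"
    by (simp add: assms(3) matrix_vector_mul_assoc)
  also have "mat2 a b 0 (inverse a) *v vector [1, 0] = a *\<^sub>R vector [1, 0]"
    by (simp add: mat2_mult_vec vec_eq_iff forall_2)
  finally have "hvec B = (hscale A / \<bar>a\<bar> * a) *\<^sub>R (A *v vector [1, 0])"
    by (simp add: hvec_def hscale_upper_triangular[OF assms] scaleR_matrix_vector)
  then show ?thesis using assms(2) by (cases "a > 0") (simp_all add: pm_eq_def hvec_def)
qed

lemma hvec_minus: "hvec (- A) = - hvec A"
proof -
  have "(- A) *v x = - (A *v x)" for x
    by (simp add: vec_eq_iff matrix_vector_mult_def sum_negf)
  then show ?thesis by (simp add: hvec_def hscale_minus)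
qed

lemma lam_eq_cross2:
  assumes "A \<in> SL2R"
  shows "lam A = \<bar>cross2 (hvec (rev_geod A)) (hvec A)\<bar>"
proof -
  obtain a b c d where A: "A = mat2 a b c d" by (rule mat2_cases)
  have det: "a * d - b * c = 1" using assms by (simp add: A mat2_SL2R)
  have "cross2 (hvec (rev_geod A)) (hvec A) = hscale (rev_geod A) * hscale A * (b * c - a * d)"
    by (simp add: hvec_def cross2_def A rev_geod_def mat2_mult mat2_mult_vec algebra_simps)
  also have "b * c - a * d = -1" using det by simp
  finally show ?thesis by (simp add: lam_eq abs_mult hscale_pos less_imp_le)
qed

lemma rev_geod_diag:
  "rev_geod (A ** mat2 a 0 0 (inverse a)) = rev_geod A ** mat2 (inverse a) 0 0 (inverse (inverse a))"
  by (simp add: rev_geod_mat2) (simp add: rev_geod_def mat2_mult flip: matrix_mul_assoc)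

lemma hscale_diag:
  assumes "cusped p V A" "a \<noteq> 0"
  shows "hscale (A ** mat2 a 0 0 (inverse a)) = hscale A / \<bar>a\<bar>"
    "hscale (rev_geod (A ** mat2 a 0 0 (inverse a))) = hscale (rev_geod A) * \<bar>a\<bar>"
  using assms hscale_upper_triangular[OF assms refl, of 0]
    hscale_upper_triangular[OF cuspedD(3)[OF assms(1)] _ rev_geod_diag, of a]
  by (simp_all add: abs_inverse divide_inverse)

lemma lam_same_line:
  assumes "cusped p V A" "same_line A B"
  shows "lam B = lam A"
proof -
  have "lam (A ** mat2 a 0 0 (inverse a)) = lam A" if "cusped p V A" "a \<noteq> 0" for A a
    using that by (simp add: lam_eq hscale_diag)
  then show ?thesis
    using assms cuspedD(3)[OF assms(1)] unfolding same_line_def by (metis lam_rev)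
qed

lemma frame_diag:
  assumes "cusped p V A" "a \<noteq> 0" "B = A ** mat2 a 0 0 (inverse a)"
  shows "pm_eq (frame B) (frame A)"
proof -
  have "frame B = A ** (mat2 a 0 0 (inverse a) ** mat2 0 (- (hscale A / \<bar>a\<bar>)) (hscale (rev_geod A) * \<bar>a\<bar>) 0)"
    using assms by (simp add: frame_def hscale_diag matrix_mul_assoc)
  also have "\<dots> = A ** (sgn a *\<^sub>R mat2 0 (- hscale A) (hscale (rev_geod A)) 0)"
    using assms(2) by (cases "a > 0") (simp_all add: mat2_mult scaleR_mat2 field_simps)
  finally have "frame B = sgn a *\<^sub>R frame A" by (simp add: frame_def scaleR_matrix_mult)
  then show ?thesis using assms(2) by (cases "a > 0") (simp_all add: pm_eq_def)
qed

lemma frame_rev: 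
  "frame (rev_geod A) = frame A ** mat2 0 (-1) 1 0"
proof -
  define \<beta>' where "\<beta>' = hscale (rev_geod A)"
  have "frame (rev_geod A) = rev_geod A ** mat2 0 (- \<beta>') (hscale A) 0"
    by (simp add: frame_def rev_rev_geod hscale_minus \<beta>'_def)
  also have "\<dots> = A ** mat2 0 (- hscale A) \<beta>' 0 ** mat2 0 (-1) 1 0"
    by (simp add: rev_geod_def mat2_mult flip: matrix_mul_assoc)
  finally show ?thesis by (simp add: frame_def \<beta>'_def)
qed

text \<open>
  The coordinates of the triangle express the third vertex in the basis given by the frame of
  \<open>b\<close>; the condition \<open>x y < 0\<close> on its position is what makes both coefficients positive, so that
  they are the ratios \<open>\<lambda>\<^sub>c / \<lambda>\<^sub>b\<close> and \<open>\<lambda>\<^sub>l / \<lambda>\<^sub>b\<close> and no further signs appear in the matrices.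
\<close>

lemma triangle_frames:
  assumes tri: "ideal_triangle b c l" and cusps: "cusped p V b" "cusped p V c" "cusped p V l"
  shows "pm_eq (frame (rev_geod l)) (frame b ** ((1 / lam b) *\<^sub>R mat2 (lam b) (lam c) 0 (lam l)))"
    and "pm_eq (frame (rev_geod c)) (frame b ** ((1 / lam b) *\<^sub>R mat2 (lam c) 0 (lam l) (lam b)))"
    and "pm_eq (hvec c) (frame b *v ((1 / lam b) *\<^sub>R vector [lam c, lam l]))"
proof -
  obtain x y k m where c: "c = b ** mat2 x (- inverse y) y 0" and l: "l = b ** mat2 0 (k * x) m (k * y)"
    and kxm: "k * x * m = -1" and xy: "x * y < 0" and y: "y \<noteq> 0"
    using ideal_triangle_coordinates[OF tri] .
  have nz: "k \<noteq> 0" "x \<noteq> 0" "m \<noteq> 0" using kxm by auto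
  define \<beta> where "\<beta> = hscale b"
  define \<beta>' where "\<beta>' = hscale (rev_geod b)"
  define \<gamma> where "\<gamma> = hscale c"
  have pos: "\<beta> > 0" "\<beta>' > 0" "\<gamma> > 0" by (simp_all add: \<beta>_def \<beta>'_def \<gamma>_def hscale_pos)
  have rc: "rev_geod c = b ** mat2 (- inverse y) (- x) 0 (- y)"
    by (simp add: c rev_geod_mat2)
  then have "rev_geod c = b ** mat2 (- inverse y) (- x) 0 (inverse (- inverse y))" by simp
  from hscale_upper_triangular[OF cusps(1) _ this] have hrc: "hscale (rev_geod c) = \<beta> * \<bar>y\<bar>"
    using y by (simp add: \<beta>_def abs_inverse divide_inverse)
  have rl: "rev_geod l = b ** mat2 (k * x) 0 (k * y) (- m)" by (simp add: l rev_geod_mat2)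
  have "mat2 x (- inverse y) y 0 ** mat2 k (- m / y) 0 (inverse k) = mat2 (k * x) 0 (k * y) (- m)"
    using kxm y nz by (simp add: mat2_mult mat2_eq_iff field_simps)
  then have "rev_geod l = c ** mat2 k (- m / y) 0 (inverse k)"
    by (simp add: rl c flip: matrix_mul_assoc)
  from hscale_upper_triangular[OF cusps(2) _ this] have hrl: "hscale (rev_geod l) = \<gamma> / \<bar>k\<bar>"
    using nz by (simp add: \<gamma>_def)
  have "inverse m = - (k * x)" by (rule inverse_unique) (use kxm in \<open>simp add: mult.commute\<close>)
  then have "l = rev_geod b ** mat2 m (k * y) 0 (inverse m)"
    by (simp add: l rev_geod_def mat2_mult flip: matrix_mul_assoc)
  from hscale_upper_triangular[OF cuspedD(3)[OF cusps(1)] _ this] have hl: "hscale l = \<beta>' / \<bar>m\<bar>"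
    using nz by (simp add: \<beta>'_def)
  have absk: "\<bar>k\<bar> * \<bar>m\<bar> * \<bar>x\<bar> = 1"
    using arg_cong[OF kxm, of abs] by (simp add: abs_mult ac_simps)
  have lams: "lam b = \<beta> * \<beta>'" "lam c = \<gamma> * \<beta> * \<bar>y\<bar>" "lam l = \<beta>' * \<gamma> * \<bar>x\<bar>"
    using absk nz by (simp_all add: lam_eq hrc hrl hl \<beta>_def \<beta>'_def \<gamma>_def field_simps)
  have sx: "k / \<bar>k\<bar> * x = - (sgn m * \<bar>x\<bar>)" and sy: "k / \<bar>k\<bar> * y = sgn m * \<bar>y\<bar>"
  proof -
    have "k * x * m < 0" by (simp add: kxm)
    then show "k / \<bar>k\<bar> * x = - (sgn m * \<bar>x\<bar>)" "k / \<bar>k\<bar> * y = sgn m * \<bar>y\<bar>"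
      using xy nz y by (auto simp: mult_less_0_iff zero_less_mult_iff)
  qed
  have "frame (rev_geod l) = b ** (mat2 (k * x) 0 (k * y) (- m) ** mat2 0 (- (\<gamma> / \<bar>k\<bar>)) (\<beta>' / \<bar>m\<bar>) 0)"
    by (simp add: frame_def rev_rev_geod hscale_minus hrl hl) (simp add: rl matrix_mul_assoc)
  also have "mat2 (k * x) 0 (k * y) (- m) ** mat2 0 (- (\<gamma> / \<bar>k\<bar>)) (\<beta>' / \<bar>m\<bar>) 0
      = mat2 0 (- \<gamma> * (k / \<bar>k\<bar> * x)) (- sgn m * \<beta>') (- \<gamma> * (k / \<bar>k\<bar> * y))"
    using nz by (simp add: mat2_mult mat2_eq_iff sgn_real_def)
  also have "\<dots> = (- sgn m) *\<^sub>R mat2 0 (- \<gamma> * \<bar>x\<bar>) \<beta>' (\<gamma> * \<bar>y\<bar>)"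
    unfolding sx sy by (simp add: scaleR_mat2 mult.left_commute)
  also have "mat2 0 (- \<gamma> * \<bar>x\<bar>) \<beta>' (\<gamma> * \<bar>y\<bar>)
      = mat2 0 (- \<beta>) \<beta>' 0 ** ((1 / lam b) *\<^sub>R mat2 (lam b) (lam c) 0 (lam l))"
    using pos by (simp add: scaleR_mat2 mat2_mult mat2_eq_iff lams)
  finally have "frame (rev_geod l) = (- sgn m) *\<^sub>R (frame b ** ((1 / lam b) *\<^sub>R mat2 (lam b) (lam c) 0 (lam l)))"
    by (simp only: scaleR_matrix_mult matrix_mul_assoc frame_def \<beta>_def \<beta>'_def)
  then show "pm_eq (frame (rev_geod l)) (frame b ** ((1 / lam b) *\<^sub>R mat2 (lam b) (lam c) 0 (lam l)))"
    using nz by (cases "m > 0") (simp_all add: pm_eq_def)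
  have "frame (rev_geod c) = b ** (mat2 (- inverse y) (- x) 0 (- y) ** mat2 0 (- (\<beta> * \<bar>y\<bar>)) \<gamma> 0)"
    by (simp add: frame_def rev_rev_geod hscale_minus hrc flip: \<gamma>_def) (simp add: rc matrix_mul_assoc)
  also have "mat2 (- inverse y) (- x) 0 (- y) ** mat2 0 (- (\<beta> * \<bar>y\<bar>)) \<gamma> 0
      = (- sgn y) *\<^sub>R mat2 (- \<gamma> * \<bar>x\<bar>) (- \<beta>) (\<gamma> * \<bar>y\<bar>) 0"
    using xy by (auto simp: mat2_mult mat2_eq_iff scaleR_mat2 mult_less_0_iff)
  also have "mat2 (- \<gamma> * \<bar>x\<bar>) (- \<beta>) (\<gamma> * \<bar>y\<bar>) 0
      = mat2 0 (- \<beta>) \<beta>' 0 ** ((1 / lam b) *\<^sub>R mat2 (lam c) 0 (lam l) (lam b))"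
    using pos by (simp add: scaleR_mat2 mat2_mult mat2_eq_iff lams)
  finally have "frame (rev_geod c) = (- sgn y) *\<^sub>R (frame b ** ((1 / lam b) *\<^sub>R mat2 (lam c) 0 (lam l) (lam b)))"
    by (simp only: scaleR_matrix_mult matrix_mul_assoc frame_def \<beta>_def \<beta>'_def)
  then show "pm_eq (frame (rev_geod c)) (frame b ** ((1 / lam b) *\<^sub>R mat2 (lam c) 0 (lam l) (lam b)))"
    using y by (cases "y > 0") (simp_all add: pm_eq_def)
  have "hvec c = b *v (\<gamma> *\<^sub>R vector [x, y])"
    by (simp add: hvec_def c scaleR_matrix_vector mat2_mult_vec flip: \<gamma>_def matrix_vector_mul_assoc)
      (simp add: \<gamma>_def c)
  also have "\<gamma> *\<^sub>R vector [x, y] = sgn y *\<^sub>R (vector [- \<gamma> * \<bar>x\<bar>, \<gamma> * \<bar>y\<bar>] :: real^2)"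
    using xy by (auto simp: vec_eq_iff forall_2 mult_less_0_iff)
  also have "vector [- \<gamma> * \<bar>x\<bar>, \<gamma> * \<bar>y\<bar>] = mat2 0 (- \<beta>) \<beta>' 0 *v ((1 / lam b) *\<^sub>R vector [lam c, lam l])"
    unfolding scaleR_matrix_vector mat2_mult_vec using pos by (simp add: vec_eq_iff forall_2 lams)
  finally have "hvec c = sgn y *\<^sub>R (frame b *v ((1 / lam b) *\<^sub>R vector [lam c, lam l]))"
    by (simp only: scaleR_matrix_vector matrix_vector_mul_assoc frame_def \<beta>_def \<beta>'_def)
  then show "pm_eq (hvec c) (frame b *v ((1 / lam b) *\<^sub>R vector [lam c, lam l]))"
    using y by (cases "y > 0") (simp_all add: pm_eq_def)
qed

end

section \<open>Crossing an edge\<close>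

context decorated_surface
begin

lemma triangle_lift_facts:
  assumes "triangle_lift p (S - V) E b c l"
  shows "ideal_triangle b c l" "edge_lift p E b" "edge_lift p E c" "edge_lift p E l"
    "cusped p V b" "cusped p V c" "cusped p V l" "b \<in> SL2R" "c \<in> SL2R" "l \<in> SL2R"
  using assms edge_lift_cusped by (auto simp: triangle_lift_def edge_lift_def)

text \<open>
  The side of a triangle through which \<open>A\<close> leaves, turned around, is the side through which it
  enters the next triangle.
\<close>

lemma frame_beyond_edge:
  assumes A: "A \<in> SL2R" and edges: "edge_lift p E c" "edge_lift p E B"
    and on: "geod A t \<in> range (geod c)" "geod A t \<in> range (geod B)"
    and before: "s < t" "geod A ` {s<..<t} \<subseteq> left_side c"
    and after: "t < t'" "geod A ` {t<..<t'} \<subseteq> left_side B"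
  shows "pm_eq (frame B) (frame (rev_geod c))"
proof -
  have "c \<in> SL2R" using edges by (simp add: edge_lift_def)
  then obtain a where "a \<noteq> 0" "B = rev_geod c ** mat2 a 0 0 (inverse a)"
    using crossing_reverses[OF _ A edge_lifts_meeting[OF edges on] before(1) after(1) before(2) on(1) after(2)] by blast
  then show ?thesis
    using frame_diag cuspedD(3)[OF edge_lift_cusped[OF edges(1)]] by blast
qed

lemma lam_meeting:
  assumes "edge_lift p E B" "edge_lift p E C" "z \<in> range (geod B)" "z \<in> range (geod C)"
  shows "lam B = lam C"
  using lam_same_line[OF edge_lift_cusped[OF assms(1)] edge_lifts_meeting[OF assms]] by simp

lemma frame_crossing:
  assumes A: "A \<in> SL2R" and cr: "crosses_triangle p (S - V) E A s t b c l" and "s < t"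
    and entering: "edge_lift p E B" "geod A t \<in> range (geod B)" "t < t'" "geod A ` {t<..<t'} \<subseteq> left_side B"
  shows "pm_eq (frame B) (frame b ** ((1 / lam b) *\<^sub>R crossing_matrix p r A t b c l))"
proof -
  have tri: "triangle_lift p (S - V) E b c l" and inside: "geod A ` {s<..<t} \<subseteq> tri_interior b c l"
    and exit: "geod A t \<in> range (geod l) \<union> range (geod c)"
    using cr by (auto simp: crosses_triangle_def)
  note T = triangle_lift_facts[OF tri]
  have left: "geod A ` {s<..<t} \<subseteq> left_side l" "geod A ` {s<..<t} \<subseteq> left_side c"
    using inside by (auto simp: tri_interior_def)
  show ?thesis
  proof (cases "geod A t \<in> range (geod l)")
    case True
    have "pm_eq (frame B) (frame (rev_geod l))"
      using frame_beyond_edge[OF A T(4) entering(1) True entering(2) \<open>s < t\<close> left(1) entering(3,4)] .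
    then show ?thesis
      using pm_eq_trans triangle_frames(1)[OF T(1,5,6,7)] True by (simp add: crossing_matrix_def)
  next
    case False
    then have on: "geod A t \<in> range (geod c)" using exit by blast
    have "pm_eq (frame B) (frame (rev_geod c))"
      using frame_beyond_edge[OF A T(3) entering(1) on entering(2) \<open>s < t\<close> left(2) entering(3,4)] .
    then show ?thesis
      using pm_eq_trans triangle_frames(2)[OF T(1,5,6,7)] False by (simp add: crossing_matrix_def)
  qed
qed

lemma nonneg_crossing_matrix: "nonneg_matrix (crossing_matrix p r A t b c l)"
  by (simp add: nonneg_matrix_def forall_2 crossing_matrix_def less_imp_le[OF lam_pos])

section \<open>Loops\<close>

text \<open>
  The shifted line, and the image of the line under the deck transformation that is right at
  time \<open>0\<close>, are lifts of the same curve.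
\<close>

lemma deck_translation:
  assumes A: "A \<in> SL2R" and period: "\<And>s. p (geod A (s + len)) = p (geod A s)"
  obtains g where "g \<in> deck p" "\<And>s. mob g (geod A s) = geod A (s + len)"
proof -
  obtain g where g: "g \<in> deck p" "mob g (geod A 0) = geod A (0 + len)"
    using deck_exists[OF geod_upper[OF A] geod_upper[OF A]] period[of 0] by metis
  have "mob g (geod A s) = geod A (s + len)" for s
  proof (rule covering_space_lift_unique[where a = 0 and f = "\<lambda>s. p (geod A s)" and T = UNIV
        and ?g1.0 = "\<lambda>s. mob g (geod A s)" and ?g2.0 = "\<lambda>s. geod A (s + len)", OF covering_p g(2)])
    show "continuous_on UNIV (\<lambda>s. p (geod A s))"
      by (rule continuous_on_compose2[OF continuous_p continuous_on_geod[OF A]]) (auto simp: geod_upper A)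
    show "continuous_on UNIV (\<lambda>s. mob g (geod A s))"
      by (rule continuous_on_compose2[OF continuous_on_mob[OF deck_SL2R[OF g(1)]] continuous_on_geod[OF A]])
         (auto simp: geod_upper A)
    show "continuous_on UNIV (\<lambda>s. geod A (s + len))"
      by (rule continuous_on_compose2[OF continuous_on_geod[OF A, of UNIV]]) (auto intro!: continuous_intros)
    show "(\<lambda>s. p (geod A s)) \<in> UNIV \<rightarrow> S - V" using p_mem geod_upper[OF A] by blast
  qed (use period A g(1) in \<open>auto simp: geod_upper mob_upper deck_SL2R[OF g(1)] deck_mob[OF g(1)]\<close>)
  with g(1) show ?thesis by (rule that)
qed

text \<open>
  The edge entered after the last crossing is the translate of the first one by the deck
  transformation \<open>g\<close> of the loop, so the frames close up to \<open>g F = \<plusminus> F Q\<close>.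
\<close>

lemma loop_formula:
  assumes A: "A \<in> SL2R" and "len > 0" and period: "\<And>s. p (geod A (s + len)) = p (geod A s)"
    and start: "p (geod A 0) \<notin> \<Union>E"
    and ce: "crossed_edges p E A {0..len} n t e"
    and t0: "t 0 = t n - len"
    and cr: "\<And>k. k \<in> {1..n} \<Longrightarrow> crosses_triangle p (S - V) E A (t (k - 1)) (t k) (b k) (rt k) (lt k)"
  shows "lambda_loop len = trace (matrix_prod (\<lambda>k. crossing_matrix p r A (t k) (b k) (rt k) (lt k)) 1 n)
            / (\<Prod>k=1..n. lam (e k))"
proof -
  have n: "n \<ge> 1" using t0 \<open>len > 0\<close> by (cases n) auto
  have mono: "strict_mono_on {1..n} t" and times: "t ` {1..n} = {s\<in>{0..len}. p (geod A s) \<in> \<Union>E}"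
    and e: "\<And>k. k \<in> {1..n} \<Longrightarrow> edge_lift p E (e k)" "\<And>k. k \<in> {1..n} \<Longrightarrow> geod A (t k) \<in> range (geod (e k))"
    using ce by (auto simp: crossed_edges_def)
  have "t 1 \<in> t ` {1..n}" "t n \<in> t ` {1..n}" using n by auto
  then have "t 1 \<in> {s\<in>{0..len}. p (geod A s) \<in> \<Union>E}" "t n \<in> {s\<in>{0..len}. p (geod A s) \<in> \<Union>E}"
    unfolding times .
  moreover from this have "t 1 \<noteq> 0" using start by auto
  ultimately have t01: "t 0 < t 1" using t0 by auto
  have less: "t (k - 1) < t k" if "k \<in> {1..n}" for k
  proof (cases "k = 1")
    case False
    then have "k - 1 \<in> {1..n}" "k - 1 < k" using that by auto
    then show ?thesis using strict_mono_onD[OF mono] that by blast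
  qed (use t01 in simp)
  obtain g where g: "g \<in> deck p" "\<And>s. mob g (geod A s) = geod A (s + len)"
    using deck_translation[OF A period] by blast
  have gSL: "g \<in> SL2R" using g(1) by (rule deck_SL2R)
  have T: "triangle_lift p (S - V) E (b k) (rt k) (lt k)"
    and entry: "geod A (t (k - 1)) \<in> range (geod (b k))"
    and inside: "geod A ` {t (k - 1)<..<t k} \<subseteq> left_side (b k)" if "k \<in> {1..n}" for k
    using cr[OF that] by (auto simp: crosses_triangle_def tri_interior_def)
  \<comment> \<open>\<open>bb k\<close> is the edge entered at time \<open>t (k - 1)\<close>, for \<open>k = n + 1\<close> as well.\<close>
  define bb where "bb k = (if k \<le> n then b k else g ** b 1)" for k
  define M where "M k = crossing_matrix p r A (t k) (b k) (rt k) (lt k)" for k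
  have b1: "b 1 \<in> SL2R" "edge_lift p E (b 1)" using triangle_lift_facts[OF T[of 1]] n by auto
  have entering: "edge_lift p E (bb (Suc k)) \<and> geod A (t k) \<in> range (geod (bb (Suc k))) \<and>
      (\<exists>t'>t k. geod A ` {t k<..<t'} \<subseteq> left_side (bb (Suc k)))" if k: "k \<in> {1..n}" for k
  proof (cases "k < n")
    case True
    then have "Suc k \<in> {1..n}" by auto
    from triangle_lift_facts(2)[OF T[OF this]] entry[OF this] inside[OF this] less[OF this]
    show ?thesis using True by (auto simp: bb_def)
  next
    case False
    then have kn: "k = n" using k by simp
    then have bbk: "bb (Suc k) = g ** b 1" by (simp add: bb_def)
    have "projected p (g ** b 1) = projected p (b 1)"
      using b1 g(1) by (simp add: projected_def image_image deck_geod)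
    then have 1: "edge_lift p E (g ** b 1)" using b1 gSL by (simp add: edge_lift_def SL2R_mult)
    have shift: "geod A s = mob g (geod A (s - len))" for s using g(2)[of "s - len"] by simp
    obtain u where "geod A (t 0) = geod (b 1) u" using entry[of 1] n by auto
    then have "geod A (t k) = geod (g ** b 1) u" using shift[of "t k"] t0 kn b1 gSL by (simp add: geod_mult)
    then have 2: "geod A (t k) \<in> range (geod (g ** b 1))" by blast
    have "geod A ` {t k<..<t 1 + len} \<subseteq> left_side (g ** b 1)"
    proof (rule image_subsetI)
      fix s assume "s \<in> {t k<..<t 1 + len}"
      then have "s - len \<in> {t (1 - 1)<..<t 1}" using t0 kn by auto
      then have "geod A (s - len) \<in> left_side (b 1)" using inside[of 1] n by (auto simp: image_subset_iff)
      then show "geod A s \<in> left_side (g ** b 1)"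
        using b1 gSL A by (subst shift) (simp add: left_side_mob_iff geod_upper)
    qed
    moreover have "t k < t 1 + len" using t01 t0 kn by simp
    ultimately show ?thesis using 1 2 bbk by metis
  qed
  have step: "pm_eq (frame (bb (Suc k))) (frame (bb k) ** ((1 / lam (bb k)) *\<^sub>R M k))" if "1 \<le> k" "k < Suc n" for k
  proof -
    have k: "k \<in> {1..n}" using that by auto
    have "bb k = b k" using k by (simp add: bb_def)
    obtain t' where "t k < t'" "geod A ` {t k<..<t'} \<subseteq> left_side (bb (Suc k))" using entering[OF k] by blast
    then show ?thesis
      using frame_crossing[OF A cr[OF k] less[OF k], of "bb (Suc k)" t'] entering[OF k] \<open>bb k = b k\<close> by (simp add: M_def)
  qed
  have lam_e: "lam (bb (Suc k)) = lam (e k)" if "k \<in> {1..n}" for k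
    using lam_meeting[of "bb (Suc k)" "e k" "geod A (t k)"] entering[OF that] e that by blast
  define P where "P = (\<Prod>k=1..n. lam (e k))"
  have "bb 1 = b 1" "bb (Suc n) = g ** b 1" using n by (simp_all add: bb_def)
  then have "lam (bb (Suc n)) = lam (bb 1)" using lam_deck[OF g(1) b1(1)] by simp
  moreover have "(\<Prod>k=1..n. lam (bb (Suc k))) = P" unfolding P_def by (intro prod.cong lam_e) auto
  ultimately have P: "(\<Prod>k=1..<Suc n. lam (bb k)) = P"
    using prod_shift[of "\<lambda>k. lam (bb k)" n] lam_pos[of "bb 1"] by (simp add: atLeastLessThanSuc_atLeastAtMost)
  have "P > 0" unfolding P_def by (intro prod_pos ballI lam_pos)
  define Q where "Q = (1 / P) *\<^sub>R matrix_chain M 1 (Suc n)"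
  have "pm_eq (frame (bb (Suc n))) (frame (bb 1) ** Q)"
    unfolding Q_def P[symmetric]
    by (rule pm_chain[where F = "\<lambda>k. frame (bb k)" and \<mu> = "\<lambda>k. lam (bb k)"]) (use step in auto)
  then have "pm_eq (g ** frame (b 1)) (frame (b 1) ** Q)"
    using frame_deck[OF g(1) b1(1)] \<open>bb 1 = b 1\<close> \<open>bb (Suc n) = g ** b 1\<close> by simp
  moreover have "det (frame (b 1)) \<noteq> 0" using det_frame[OF b1(1)] lam_pos[of "b 1"] by simp
  then obtain F' where F': "frame (b 1) ** F' = mat 1" "F' ** frame (b 1) = mat 1"
    using invertible_det_nz invertible_def by metis
  ultimately have "pm_eq ((g ** frame (b 1)) ** F') ((frame (b 1) ** Q) ** F')" by (intro pm_eq_mult)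
  then have "pm_eq g (frame (b 1) ** Q ** F')"
    by (simp only: F' matrix_mul_rid matrix_mul_assoc[symmetric])
  then have "\<bar>trace g\<bar> = \<bar>trace (frame (b 1) ** Q ** F')\<bar>"
    by (auto simp: pm_eq_def trace_def sum_2)
  also have "trace (frame (b 1) ** Q ** F') = trace (F' ** (frame (b 1) ** Q))" by (rule trace_mul_sym)
  also have "\<dots> = trace Q" by (simp only: F' matrix_mul_assoc matrix_mul_lid)
  also have "trace Q = trace (matrix_chain M 1 (Suc n)) / P" by (simp add: Q_def trace_def sum_2 add_divide_distrib)
  also have "\<bar>\<dots>\<bar> = trace (matrix_chain M 1 (Suc n)) / P"
  proof -
    have "nonneg_matrix (matrix_chain M 1 (Suc n))"
      by (rule nonneg_matrix_chain) (simp add: M_def nonneg_crossing_matrix)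
    then show ?thesis using \<open>P > 0\<close> by (simp add: nonneg_matrix_def trace_def sum_2)
  qed
  finally have "\<bar>trace g\<bar> = trace (matrix_chain M 1 (Suc n)) / P" .
  then have "lambda_loop len = trace (matrix_chain M 1 (Suc n)) / P"
    using trace_translation[OF A gSL g(2)] by (simp add: lambda_loop_def)
  then show ?thesis by (simp only: matrix_prod_def matrix_chain_def M_def P_def)
qed

section \<open>Arcs\<close>

lemma hvec_opposite_vertex:
  assumes A: "A \<in> SL2R" and st: "starts_in_triangle p (S - V) E A t x left right"
  shows "pm_eq (hvec (rev_geod A)) (frame x *v ((1 / lam x) *\<^sub>R vector [lam left, lam right]))"
proof -
  have tri: "triangle_lift p (S - V) E x left right"
    and inside: "geod A ` {..<t} \<subseteq> tri_interior x left right" "geod A t \<in> range (geod x)"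
    using st by (auto simp: starts_in_triangle_def)
  note T = triangle_lift_facts[OF tri]
  obtain a b where "a \<noteq> 0" "rev_geod A = left ** mat2 a b 0 (inverse a)"
    using starts_at_opposite_vertex[OF T(1) A inside] .
  from hvec_upper_triangular[OF T(6) this] triangle_frames(3)[OF T(1,5,6,7)]
  show ?thesis by (rule pm_eq_trans)
qed

lemma finishes_rev:
  assumes "A \<in> SL2R" "finishes_in_triangle p X E A s b right left"
  shows "starts_in_triangle p X E (rev_geod A) (- s) b right left"
proof -
  have "geod (rev_geod A) u \<in> tri_interior b right left" if "u < - s" for u
  proof -
    have "- u \<in> {s<..}" using that by simp
    then have "geod A (- u) \<in> tri_interior b right left"
      using assms(2) by (auto simp: finishes_in_triangle_def image_subset_iff)
    then show ?thesis using assms(1) by (simp add: geod_rev)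
  qed
  then show ?thesis
    using assms by (auto simp: starts_in_triangle_def finishes_in_triangle_def geod_rev)
qed

text \<open>
  The vectors of the two ends are \<open>F v\<close> and \<open>F w\<close> up to sign, where \<open>F\<close> is the frame of the first crossed
  edge, the coordinates \<open>v\<close> come from the first triangle, and \<open>w\<close> is the product of the crossing
  matrices, divided by \<open>\<lambda>\<close>-lengths, applied to the coordinates from the last triangle.  Since \<open>det F = \<lambda>\<^sub>x\<close>, the factor
  \<open>1 / \<lambda>\<^sub>x\<close> in \<open>v\<close> cancels, and the other denominators are one for each crossed edge.
\<close>

lemma arc_formula:
  assumes A: "A \<in> SL2R" and ce: "crossed_edges p E A UNIV n t e"
    and st: "starts_in_triangle p (S - V) E A (t 1) x left right"
    and cr: "\<And>k. k \<in> {2..n} \<Longrightarrow> crosses_triangle p (S - V) E A (t (k - 1)) (t k) (b k) (rt k) (lt k)"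
    and fin: "finishes_in_triangle p (S - V) E A (t n) b' right' left'"
  shows "lam A = (vector [lam left, lam right] :: real^2)
            \<bullet> (matrix_prod (\<lambda>k. crossing_matrix p r A (t k) (b k) (rt k) (lt k)) 2 n
                *v vector [lam right', lam left']) / (\<Prod>k=1..n. lam (e k))"
proof -
  have mono: "strict_mono_on {1..n} t" and times: "t ` {1..n} = {s. p (geod A s) \<in> \<Union>E}"
    and e: "\<And>k. k \<in> {1..n} \<Longrightarrow> edge_lift p E (e k)" "\<And>k. k \<in> {1..n} \<Longrightarrow> geod A (t k) \<in> range (geod (e k))"
    using ce by (auto simp: crossed_edges_def)
  have trix: "triangle_lift p (S - V) E x left right" and onx: "geod A (t 1) \<in> range (geod x)"
    and inx: "geod A ` {..<t 1} \<subseteq> tri_interior x left right"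
    using st by (auto simp: starts_in_triangle_def)
  note X = triangle_lift_facts[OF trix]
  have trib: "triangle_lift p (S - V) E b' right' left'" and onb: "geod A (t n) \<in> range (geod b')"
    and inb: "geod A ` {t n<..} \<subseteq> tri_interior b' right' left'"
    using fin by (auto simp: finishes_in_triangle_def)
  note B = triangle_lift_facts[OF trib]
  have "p (geod A (t 1)) \<in> projected p x" unfolding projected_def using onx by (rule imageI)
  then have "p (geod A (t 1)) \<in> \<Union>E" using X(2) by (auto simp: edge_lift_def)
  then have "t ` {1..n} \<noteq> {}" using times by blast
  then have n: "n \<ge> 1" by simp
  have less: "t (k - 1) < t k" if "k \<in> {2..n}" for k
  proof -
    have "k - 1 \<in> {1..n}" "k - 1 < k" "k \<in> {1..n}" using that by auto
    then show ?thesis using strict_mono_onD[OF mono] by blast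
  qed
  have T: "triangle_lift p (S - V) E (b k) (rt k) (lt k)"
    and entry: "geod A (t (k - 1)) \<in> range (geod (b k))"
    and inside: "geod A ` {t (k - 1)<..<t k} \<subseteq> left_side (b k)" if "k \<in> {2..n}" for k
    using cr[OF that] by (auto simp: crosses_triangle_def tri_interior_def)
  \<comment> \<open>Only the indices \<open>2, \<dots>, n + 1\<close> are edges entered by the arc; the first crossed edge appears
    twice, as \<open>x\<close> seen from the first triangle and as \<open>bb 2\<close> seen from the second.\<close>
  define bb where "bb k = (if k = 1 then x else if k \<le> n then b k else b')" for k
  define M where "M k = crossing_matrix p r A (t k) (b k) (rt k) (lt k)" for k
  have entering: "edge_lift p E (bb (Suc k)) \<and> geod A (t k) \<in> range (geod (bb (Suc k))) \<and>
      (\<exists>t'>t k. geod A ` {t k<..<t'} \<subseteq> left_side (bb (Suc k)))" if k: "k \<in> {1..n}" for k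
  proof (cases "k < n")
    case True
    then have "Suc k \<in> {2..n}" using k by auto
    from triangle_lift_facts(2)[OF T[OF this]] entry[OF this] inside[OF this] less[OF this]
    show ?thesis using True k by (auto simp: bb_def)
  next
    case False
    then have kn: "k = n" "bb (Suc k) = b'" using k by (simp_all add: bb_def)
    have "geod A ` {t n<..<t n + 1} \<subseteq> left_side b'"
      using inb by (auto simp: tri_interior_def image_subset_iff)
    then show ?thesis using kn B(2) onb by (auto intro!: exI[of _ "t n + 1"])
  qed
  have step: "pm_eq (frame (bb (Suc k))) (frame (bb k) ** ((1 / lam (bb k)) *\<^sub>R M k))" if "2 \<le> k" "k < Suc n" for k
  proof -
    have k: "k \<in> {2..n}" "k \<in> {1..n}" using that by auto
    have "bb k = b k" using k by (simp add: bb_def)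
    obtain t' where "t k < t'" "geod A ` {t k<..<t'} \<subseteq> left_side (bb (Suc k))" using entering[OF k(2)] by blast
    then show ?thesis
      using frame_crossing[OF A cr[OF k(1)] less[OF k(1)], of "bb (Suc k)" t'] entering[OF k(2)] \<open>bb k = b k\<close> by (simp add: M_def)
  qed
  have lam_e: "lam (bb (Suc k)) = lam (e k)" if "k \<in> {1..n}" for k
    using lam_meeting[of "bb (Suc k)" "e k" "geod A (t k)"] entering[OF that] e that by blast
  have bb1: "bb 1 = x" and bbn: "bb (Suc n) = b'" using n by (simp_all add: bb_def)
  have lam2: "lam (bb 2) = lam x"
    using lam_meeting[of "bb 2" x "geod A (t 1)"] entering[of 1] n X(2) onx by (simp add: numeral_2_eq_2)
  define P where "P = (\<Prod>k=1..n. lam (e k))"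
  define P' where "P' = (\<Prod>k=2..<Suc n. lam (bb k))"
  have P: "P = P' * lam b'"
  proof -
    have "P = (\<Prod>k=1..n. lam (bb (Suc k)))" unfolding P_def by (intro prod.cong lam_e[symmetric]) auto
    also have "\<dots> = (\<Prod>k=2..Suc n. lam (bb k))"
      by (rule prod.reindex_bij_witness[of _ "\<lambda>k. k - 1" Suc]) auto
    also have "\<dots> = P' * lam (bb (Suc n))" using n by (simp add: P'_def atLeastLessThanSuc_atLeastAtMost)
    finally show ?thesis by (simp add: bbn)
  qed
  have "P' > 0" unfolding P'_def by (intro prod_pos ballI lam_pos)
  define Q where "Q = matrix_chain M 2 (Suc n)"
  have chain: "pm_eq (frame b') (frame (bb 2) ** ((1 / P') *\<^sub>R Q))"
    unfolding Q_def P'_def bbn[symmetric]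
    by (rule pm_chain[where F = "\<lambda>k. frame (bb k)" and \<mu> = "\<lambda>k. lam (bb k)"]) (use step n in auto)
  obtain t' where t': "t 1 < t'" "geod A ` {t 1<..<t'} \<subseteq> left_side (bb 2)"
    using entering[of 1] n by (auto simp: numeral_2_eq_2)
  have e2: "edge_lift p E (bb 2)" "geod A (t 1) \<in> range (geod (bb 2))"
    using entering[of 1] n by (auto simp: numeral_2_eq_2)
  have "geod A ` {t 1 - 1<..<t 1} \<subseteq> left_side x" using inx by (auto simp: tri_interior_def image_subset_iff)
  then have "pm_eq (frame (bb 2)) (frame x ** mat2 0 (-1) 1 0)"
    using frame_beyond_edge[OF A X(2) e2(1) onx e2(2) _ _ t', of "t 1 - 1"] by (simp add: frame_rev)
  \<comment> \<open>Turning \<open>x\<close> around exchanges the columns of its frame with a sign; this step inverts that.\<close>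
  from pm_eq_mult(1)[OF this, of "mat2 0 1 (-1) 0"]
  have fx: "pm_eq (frame x) (frame (bb 2) ** mat2 0 1 (-1) 0)"
    by (simp add: mat2_mult matrix_mul_rid pm_eq_sym flip: matrix_mul_assoc mat_1_mat2)
  define v where "v = (1 / lam x) *\<^sub>R (vector [lam right, - lam left] :: real^2)"
  define w where "w = (1 / P) *\<^sub>R (Q *v vector [lam right', lam left'])"
  have "pm_eq (hvec (rev_geod A)) (frame x *v ((1 / lam x) *\<^sub>R vector [lam left, lam right]))"
    by (rule hvec_opposite_vertex[OF A st])
  also have "pm_eq \<dots> (frame (bb 2) ** mat2 0 1 (-1) 0 *v ((1 / lam x) *\<^sub>R vector [lam left, lam right]))"
    by (rule pm_eq_mult_vec[OF fx])
  also have "\<dots> = frame (bb 2) *v v"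
    by (simp add: v_def scaleR_matrix_vector mat2_mult_vec flip: matrix_vector_mul_assoc)
  finally have start: "pm_eq (hvec (rev_geod A)) (frame (bb 2) *v v)" .
  have "pm_eq (hvec (rev_geod (rev_geod A))) (frame b' *v ((1 / lam b') *\<^sub>R vector [lam right', lam left']))"
    by (rule hvec_opposite_vertex[OF rev_geod_SL2R[OF A] finishes_rev[OF A fin]])
  then have "pm_eq (hvec A) (frame b' *v ((1 / lam b') *\<^sub>R vector [lam right', lam left']))"
    unfolding rev_rev_geod hvec_minus pm_eq_def by (metis minus_minus)
  also have "pm_eq \<dots> (frame (bb 2) ** ((1 / P') *\<^sub>R Q) *v ((1 / lam b') *\<^sub>R vector [lam right', lam left']))"
    by (rule pm_eq_mult_vec[OF chain])
  also have "\<dots> = frame (bb 2) *v w"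
    by (simp add: w_def P scaleR_matrix_vector scaleR_matrix_mult matrix_vector_mul_assoc mult.commute)
  finally have finish: "pm_eq (hvec A) (frame (bb 2) *v w)" .
  have "lam A = \<bar>det (frame (bb 2)) * cross2 v w\<bar>"
    using lam_eq_cross2[OF A] cross2_pm[OF start finish] by (simp add: cross2_matrix)
  also have "det (frame (bb 2)) = lam x" using det_frame e2(1) lam2 by (simp add: edge_lift_def)
  also have "lam x * cross2 v w = vector [lam left, lam right] \<bullet> w"
    using lam_pos[of x] by (simp add: cross2_def v_def inner_vec_def sum_2 field_simps)
  also have "\<dots> = (vector [lam left, lam right] \<bullet> (Q *v vector [lam right', lam left'])) / P"
    by (simp add: w_def)
  also have "\<bar>\<dots>\<bar> = \<dots>"
  proof -
    have "nonneg_matrix Q"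
      unfolding Q_def by (rule nonneg_matrix_chain) (simp add: M_def nonneg_crossing_matrix)
    then have "0 \<le> (vector [lam left, lam right] :: real^2) \<bullet> (Q *v vector [lam right', lam left'])"
      by (simp add: inner_vec_def sum_2 matrix_vector_mult_def nonneg_matrix_def less_imp_le[OF lam_pos])
    moreover have "P > 0" using \<open>P' > 0\<close> lam_pos by (simp add: P)
    ultimately show ?thesis by simp
  qed
  finally show ?thesis by (simp only: matrix_prod_def matrix_chain_def M_def P_def Q_def)
qed

end

section \<open>The formula for lambda-lengths\<close>

theorem theoremB1:
  fixes S V :: "'a::t2_space set" and d :: "'a \<Rightarrow> 'a \<Rightarrow> real" and p :: "complex \<Rightarrow> 'a"
    and r :: "'a \<Rightarrow> real" and E :: "'a set set"
  assumes "closed_surface S" and "finite V" and "V \<subseteq> S" and "V \<noteq> {}"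
    and "complete_hyperbolic_metric (S - V) d"
    and "oriented_universal_covering p (S - V) d"
    and "finite_area p (S - V)"
    and "decoration p V r"
    and "ideal_triangulation p S V E"
    and "euler_char S V E < 0"
  shows
    "(\<forall>\<alpha> A len n t e b rt lt.
        is_loop (S - V) \<alpha> \<and> loop_geodesic p (S - V) \<alpha> A len \<and>
        p (geod A 0) \<notin> \<Union>E \<and>
        crossed_edges p E A {0..len} n t e \<and>
        t 0 = t n - len \<and>
        (\<forall>k\<in>{1..n}. crosses_triangle p (S - V) E A (t (k - 1)) (t k) (b k) (rt k) (lt k))
        \<longrightarrow>
        lambda_loop len =
          trace (matrix_prod (\<lambda>k. crossing_matrix p r A (t k) (b k) (rt k) (lt k)) 1 n)
            / (\<Prod>k=1..n. lambda_arc p r (e k))) \<and>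
     (\<forall>\<alpha> A n t e b rt lt x left right b' right' left'.
        is_arc S V \<alpha> \<and> arc_geodesic p S V \<alpha> A \<and>
        \<not> (\<exists>B. arc_geodesic p S V \<alpha> B \<and> projected p B \<in> E) \<and>
        crossed_edges p E A UNIV n t e \<and>
        starts_in_triangle p (S - V) E A (t 1) x left right \<and>
        (\<forall>k\<in>{2..n}. crosses_triangle p (S - V) E A (t (k - 1)) (t k) (b k) (rt k) (lt k)) \<and>
        finishes_in_triangle p (S - V) E A (t n) b' right' left'
        \<longrightarrow>
        lambda_arc p r A =
          (vector [lambda_arc p r left, lambda_arc p r right] :: real^2)
            \<bullet> (matrix_prod (\<lambda>k. crossing_matrix p r A (t k) (b k) (rt k) (lt k)) 2 n
                *v vector [lambda_arc p r right', lambda_arc p r left'])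
            / (\<Prod>k=1..n. lambda_arc p r (e k)))"
proof -
  interpret decorated_surface S V d p E r
    using assms by unfold_locales (auto simp: closed_surface_def)
  show ?thesis
  proof (intro conjI allI impI)
    fix \<alpha> A len n t e b rt lt
    assume *: "is_loop (S - V) \<alpha> \<and> loop_geodesic p (S - V) \<alpha> A len \<and>
        p (geod A 0) \<notin> \<Union>E \<and>
        crossed_edges p E A {0..len} n t e \<and>
        t 0 = t n - len \<and>
        (\<forall>k\<in>{1..n}. crosses_triangle p (S - V) E A (t (k - 1)) (t k) (b k) (rt k) (lt k))"
    then have "A \<in> SL2R" "len > 0" "\<And>s. p (geod A (s + len)) = p (geod A s)"
      by (auto simp: loop_geodesic_def)
    with * show "lambda_loop len =
          trace (matrix_prod (\<lambda>k. crossing_matrix p r A (t k) (b k) (rt k) (lt k)) 1 n)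
            / (\<Prod>k=1..n. lambda_arc p r (e k))"
      by (intro loop_formula) auto
  next
    fix \<alpha> A n t e b rt lt x left right b' right' left'
    assume *: "is_arc S V \<alpha> \<and> arc_geodesic p S V \<alpha> A \<and>
        \<not> (\<exists>B. arc_geodesic p S V \<alpha> B \<and> projected p B \<in> E) \<and>
        crossed_edges p E A UNIV n t e \<and>
        starts_in_triangle p (S - V) E A (t 1) x left right \<and>
        (\<forall>k\<in>{2..n}. crosses_triangle p (S - V) E A (t (k - 1)) (t k) (b k) (rt k) (lt k)) \<and>
        finishes_in_triangle p (S - V) E A (t n) b' right' left'"
    then have "A \<in> SL2R" by (auto simp: arc_geodesic_def)
    with * show "lambda_arc p r A =
          (vector [lambda_arc p r left, lambda_arc p r right] :: real^2)
            \<bullet> (matrix_prod (\<lambda>k. crossing_matrix p r A (t k) (b k) (rt k) (lt k)) 2 n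
                *v vector [lambda_arc p r right', lambda_arc p r left'])
            / (\<Prod>k=1..n. lambda_arc p r (e k))"
      by (intro arc_formula) auto
  qed
qed

end
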